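(* Let $d\ge4$ and let $s$ be an integer with $2d\le s\le d^2$. Let $\ell:\mathbb R_+\to\mathbb R_+$ be a nondecreasing function with $\ell(0)=0$ and $\ell\not\equiv0$. Assume that the Lévy triplet of $Z$ is $(0,\mathrm{Id}_{d\times d},0)$, i.e. $Z$ is a standard $d$-dimensional Wiener process. Then, for $1\le p<\infty$, there exist positive constants $c,c'$, depending only on $\ell(\cdot)$, such that $$\inf_{\hat A}\ \sup_{A_0\in M_+(\mathbb R^d)\cap\mathbb B_0(s)}\mathbb E_{A_0}\left[\ell\left(c\,\psi_{T,p}^{-1}\|\hat A-A_0\|_p\right)\right]\ge c',$$ where the infimum extends over all estimators of $A_0$ (based on the observation of $(X_t)_{t\in[0,T]}$) and $$\psi_{T,p}:=s^{1/p}\sqrt{\frac{\log(\mathrm e d^2/s)}{T}}.$$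
   Context: For $A_0\in\mathbb R^{d\times d}$, the Ornstein–Uhlenbeck process $X$ solves $dX_t=-A_0X_t\,dt+dZ_t$, with $X_0$ independent of $Z$, and a continuous record $(X_t)_{t\in[0,T]}$, $T>0$, is observed. $M_+(\mathbb R^d)$ is the set of real $d\times d$ matrices all of whose eigenvalues have positive real part. For $A_0\in M_+(\mathbb R^d)$, $\mathbb E_{A_0}$ is the expectation under the law with drift parameter $A_0$ and $X_0$ distributed according to the invariant distribution, i.e. $X$ is stationary (standing assumption). $\mathbb B_0(s)=\{B\in\mathbb R^{d\times d}:\|B\|_0\le s\}$, where $\|B\|_0$ is the number of non-zero entries of $B$; $\|B\|_p=(\sum_{i,j}|B_{ij}|^p)^{1/p}$ is the entrywise $p$-norm; $\mathrm e$ is Euler's number. *)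

theory Defs
  imports "HOL-Probability.Probability" "Jordan_Normal_Form.Char_Poly"
begin

text \<open>The dimension \<open>d\<close> has to be quantified inside formulas (constants must not depend on it),
  so a point of the state space is a function in \<open>{..<d} \<rightarrow>\<^sub>E UNIV\<close>, and a path over the
  time set \<open>I\<close> is an extensional function on \<open>I\<close>. The product sigma-algebra on paths is generated by
  the coordinate evaluations; on the set of continuous paths over a compact interval it induces the
  Borel sigma-algebra of uniform convergence.\<close>

definition state_space :: "nat \<Rightarrow> (nat \<Rightarrow> real) measure" where
  "state_space d = (\<Pi>\<^sub>M i\<in>{..<d}. (borel :: real measure))"

definition path_space :: "nat \<Rightarrow> real set \<Rightarrow> (real \<Rightarrow> nat \<Rightarrow> real) measure" where
  "path_space d I = (\<Pi>\<^sub>M t\<in>I. state_space d)"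

definition path :: "real set \<Rightarrow> (real \<Rightarrow> 'w \<Rightarrow> nat \<Rightarrow> real) \<Rightarrow> 'w \<Rightarrow> real \<Rightarrow> nat \<Rightarrow> real" where
  "path I X w = (\<lambda>t\<in>I. X t w)"

definition increment :: "nat \<Rightarrow> (real \<Rightarrow> 'w \<Rightarrow> nat \<Rightarrow> real) \<Rightarrow> real \<Rightarrow> real \<Rightarrow> 'w \<Rightarrow> nat \<Rightarrow> real" where
  "increment d Z u t w = (\<lambda>i\<in>{..<d}. Z t w i - Z u w i)"

definition stochastic_process ::
    "nat \<Rightarrow> 'w measure \<Rightarrow> (real \<Rightarrow> 'w \<Rightarrow> nat \<Rightarrow> real) \<Rightarrow> bool" where
  "stochastic_process d M X \<longleftrightarrow> prob_space M \<and> (\<forall>t\<ge>0. X t \<in> M \<rightarrow>\<^sub>M state_space d)"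

definition continuous_paths ::
    "nat \<Rightarrow> 'w measure \<Rightarrow> (real \<Rightarrow> 'w \<Rightarrow> nat \<Rightarrow> real) \<Rightarrow> bool" where
  "continuous_paths d M X \<longleftrightarrow> (AE w in M. \<forall>i<d. continuous_on {0..} (\<lambda>t. X t w i))"

definition standard_wiener ::
    "nat \<Rightarrow> 'w measure \<Rightarrow> (real \<Rightarrow> 'w \<Rightarrow> nat \<Rightarrow> real) \<Rightarrow> bool" where
  "standard_wiener d M Z \<longleftrightarrow>
     stochastic_process d M Z \<and>
     continuous_paths d M Z \<and>
     (AE w in M. \<forall>i<d. Z 0 w i = 0) \<and>
     (\<forall>n (t :: nat \<Rightarrow> real). 0 \<le> t 0 \<and> mono t \<longrightarrow>
        prob_space.indep_vars M (\<lambda>_. state_space d) (\<lambda>k. increment d Z (t k) (t (Suc k))) {..<n}) \<and>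
     (\<forall>u t. 0 \<le> u \<and> u < t \<longrightarrow>
        distr M (state_space d) (increment d Z u t) =
        (\<Pi>\<^sub>M i\<in>{..<d}. density lborel (\<lambda>x. ennreal (normal_density 0 (sqrt (t - u)) x))))"

definition stationary_process ::
    "nat \<Rightarrow> 'w measure \<Rightarrow> (real \<Rightarrow> 'w \<Rightarrow> nat \<Rightarrow> real) \<Rightarrow> bool" where
  "stationary_process d M X \<longleftrightarrow>
     (\<forall>h\<ge>0. distr M (path_space d {0..}) (path {0..} (\<lambda>t. X (t + h))) =
            distr M (path_space d {0..}) (path {0..} X))"

text \<open>As the noise is additive, \<open>dX\<^sub>t = - A X\<^sub>t dt + dZ\<^sub>t\<close> is a pathwise integral equation.
  \<^const>\<open>prob_space.indep_var\<close> needs both variables to have the same type, so \<open>X\<^sub>0\<close> enters as the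
  path over \<open>{0}\<close>.\<close>

definition stationary_OU ::
    "nat \<Rightarrow> real mat \<Rightarrow> 'w measure \<Rightarrow> (real \<Rightarrow> 'w \<Rightarrow> nat \<Rightarrow> real) \<Rightarrow>
     (real \<Rightarrow> 'w \<Rightarrow> nat \<Rightarrow> real) \<Rightarrow> bool" where
  "stationary_OU d A M X Z \<longleftrightarrow>
     standard_wiener d M Z \<and>
     stochastic_process d M X \<and>
     continuous_paths d M X \<and>
     prob_space.indep_var M (path_space d {0}) (path {0} X) (path_space d {0..}) (path {0..} Z) \<and>
     (AE w in M. \<forall>t\<ge>0. \<forall>i<d.
        X t w i = X 0 w i - integral {0..t} (\<lambda>u. \<Sum>j<d. A $$ (i, j) * X u w j) + Z t w i) \<and>
     stationary_process d M X"

text \<open>The law of \<open>(X\<^sub>t)\<close>, \<open>0 \<le> t \<le> T\<close>. The sample points are taken from the type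
  \<^typ>\<open>real \<Rightarrow> nat \<Rightarrow> real\<close>, which loses nothing: the measure \<open>M\<close> is arbitrary, and this type
  can carry a pair \<open>(X, Z)\<close> of paths (one on the nonnegative, one on the negative times), so every
  stationary solution on any probability space has a copy in law here.\<close>

definition is_OU_law :: "nat \<Rightarrow> real mat \<Rightarrow> real \<Rightarrow> (real \<Rightarrow> nat \<Rightarrow> real) measure \<Rightarrow> bool" where
  "is_OU_law d A T P \<longleftrightarrow>
     (\<exists>(M :: (real \<Rightarrow> nat \<Rightarrow> real) measure) X Z.
        stationary_OU d A M X Z \<and> P = distr M (path_space d {0..T}) (path {0..T} X))"

definition estimators :: "nat \<Rightarrow> real \<Rightarrow> ((real \<Rightarrow> nat \<Rightarrow> real) \<Rightarrow> real mat) set" where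
  "estimators d T =
     {Ahat. (\<forall>x\<in>space (path_space d {0..T}). Ahat x \<in> carrier_mat d d) \<and>
            (\<forall>i<d. \<forall>j<d. (\<lambda>x. Ahat x $$ (i, j)) \<in> borel_measurable (path_space d {0..T}))}"

definition M_plus :: "nat \<Rightarrow> real mat set" where
  "M_plus d = {A \<in> carrier_mat d d.
     \<forall>k. eigenvalue (map_mat complex_of_real A) k \<longrightarrow> 0 < Re k}"

definition norm0_mat :: "real mat \<Rightarrow> nat" where
  "norm0_mat B = card {(i, j). i < dim_row B \<and> j < dim_col B \<and> B $$ (i, j) \<noteq> 0}"

definition B_zero :: "nat \<Rightarrow> nat \<Rightarrow> real mat set" where
  "B_zero d s = {B \<in> carrier_mat d d. norm0_mat B \<le> s}"

definition pnorm_mat :: "real \<Rightarrow> real mat \<Rightarrow> real" where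
  "pnorm_mat p B = (\<Sum>i<dim_row B. \<Sum>j<dim_col B. \<bar>B $$ (i, j)\<bar> powr p) powr (1 / p)"

definition psi :: "nat \<Rightarrow> nat \<Rightarrow> real \<Rightarrow> real \<Rightarrow> real" where
  "psi d s T p = real s powr (1 / p) * sqrt (ln (exp 1 * (real d)\<^sup>2 / real s) / T)"

end

theory Submission
  imports Defs
begin

text \<open>The set of admissible drifts is unbounded, and a strong drift damps the process. With drift
\<open>\<lambda> Id\<close> every coordinate of the stationary solution has variance \<open>1 / (2 \<lambda>)\<close>, so an entry of the
drift matrix acts on a signal that vanishes as \<open>\<lambda>\<close> grows. Hence the two matrices \<open>A = \<lambda> Id\<close> and
\<open>B = \<lambda> Id + \<delta> E\<^sub>0\<^sub>1\<close>, which have at most \<open>d + 1 \<le> s\<close> non-zero entries and the only eigenvalue \<open>\<lambda>\<close>,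
become statistically indistinguishable as \<open>\<lambda> \<rightarrow> \<infinity>\<close>, whatever \<open>\<delta>\<close> and \<open>T\<close> are: the relevant
information is of order \<open>\<delta>\<^sup>2 (1 / \<lambda>\<^sup>2 + T / \<lambda>)\<close>. Choosing \<open>\<delta>\<close> as a multiple of \<open>\<psi>\<close> and then \<open>\<lambda>\<close>
large, Le Cam's method with these two hypotheses gives the bound, since an estimator of the entry
\<open>(0, 1)\<close> misses by at least \<open>\<delta> / 2\<close> either \<open>0\<close> or \<open>\<delta>\<close>.

The work is in comparing the two laws of a continuous record. In \<open>B\<close> the coordinate 1 is
autonomous, and conditionally on it the coordinate 0 has the law that it has under \<open>A\<close>, up to a
translation. This is a Cameron--Martin situation: a translation of Gaussian noise by \<open>s\<close> changes
integrals in a way controlled by the squared norm of \<open>s\<close> (\<open>gauss_shift_two_point\<close>). It is carried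
out for an Euler scheme that is started at 0 a long time before the observation, so that all that
matters is a finite Gaussian vector (\<open>euler_two_point\<close>). The translation that reproduces the effect
of \<open>\<delta>\<close> before the observation starts is spread over this prehistory in the cheapest way (\<open>steer\<close>); without this,
its norm would grow with the length of the prehistory.

The scheme is then related to the process. By stationarity the record over \<open>[0, T]\<close> has the law of
the record over \<open>[h, h + T]\<close>; by then the influence of the starting value has decayed
exponentially, and refining the grid removes the discretization error
(\<open>euler_converges\<close>, \<open>OU_law_approximation\<close>). The scheme started in the remote past thus takes the
place of the invariant law. Both limits are taken for Lipschitz functions of finitely many coordinates, and these
approximate every event of the path space simultaneously under both laws
(\<open>lipschitz_test_approximation\<close>), which yields \<open>OU_two_point\<close>.\<close>

section \<open>Translations of Gaussian product measures\<close>

definition gauss :: "real \<Rightarrow> real measure" where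
  "gauss v = density lborel (\<lambda>x. ennreal (normal_density 0 (sqrt v) x))"

text \<open>The density of the normal law with mean \<open>s\<close> and variance \<open>v\<close> with respect to the centred one.\<close>

definition shift_density :: "real \<Rightarrow> real \<Rightarrow> real \<Rightarrow> real" where
  "shift_density v s x = exp ((s * x - s\<^sup>2 / 2) / v)"

lemma sets_gauss [measurable_cong, simp]: "sets (gauss v) = sets borel"
  by (simp add: gauss_def)

lemma space_gauss [simp]: "space (gauss v) = UNIV"
  by (simp add: gauss_def)

lemma measurable_shift_density [measurable]: "shift_density v s \<in> borel_measurable borel"
  unfolding shift_density_def by measurable

lemma prob_space_gauss: "0 < v \<Longrightarrow> prob_space (gauss v)"
  unfolding gauss_def by (rule prob_space_normal_density) simp

lemma product_sigma_finite_gauss: "0 < v \<Longrightarrow> product_sigma_finite (\<lambda>_. gauss v)"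
  by (simp add: product_sigma_finite_def prob_space_gauss prob_space_imp_sigma_finite)

lemma nn_integral_gauss_shift:
  assumes v: "0 < v" and [measurable]: "\<phi> \<in> borel_measurable borel"
  shows "(\<integral>\<^sup>+x. \<phi> (x + s) \<partial>gauss v) = (\<integral>\<^sup>+x. \<phi> x * ennreal (shift_density v s x) \<partial>gauss v)"
proof -
  have dens: "normal_density 0 (sqrt v) (x - s) = normal_density 0 (sqrt v) x * shift_density v s x" for x
    using v by (simp add: normal_density_def shift_density_def exp_add [symmetric] field_simps
        power2_eq_square)
  have "(\<integral>\<^sup>+x. \<phi> (x + s) \<partial>gauss v)
      = (\<integral>\<^sup>+x. ennreal (normal_density 0 (sqrt v) x) * \<phi> (x + s) \<partial>lborel)"
    by (simp add: gauss_def nn_integral_density)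
  also have "\<dots> = (\<integral>\<^sup>+x. ennreal (normal_density 0 (sqrt v) (x - s)) * \<phi> x \<partial>lborel)"
    by (subst nn_integral_real_affine [where t = s and c = 1]) (auto simp: algebra_simps)
  also have "\<dots> = (\<integral>\<^sup>+x. ennreal (normal_density 0 (sqrt v) x) *
      (\<phi> x * ennreal (shift_density v s x)) \<partial>lborel)"
    by (simp add: dens ennreal_mult shift_density_def mult_ac)
  finally show ?thesis
    by (simp add: gauss_def nn_integral_density)
qed

text \<open>The product structure makes the Cameron--Martin density a product; the induction integrates out
one coordinate at a time.\<close>

lemma nn_integral_PiM_gauss_shift:
  fixes s :: "'i \<Rightarrow> real"
  assumes v: "0 < v" and "finite J"
    and "F \<in> borel_measurable (PiM J (\<lambda>_. borel :: real measure))"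
  shows "(\<integral>\<^sup>+g. F (\<lambda>j\<in>J. g j + s j) \<partial>PiM J (\<lambda>_. gauss v))
       = (\<integral>\<^sup>+g. F g * (\<Prod>j\<in>J. ennreal (shift_density v (s j) (g j))) \<partial>PiM J (\<lambda>_. gauss v))"
  using assms(2,3)
proof (induction J arbitrary: F rule: finite_induct)
  case empty
  then show ?case
    by (simp add: PiM_empty nn_integral_count_space_finite)
next
  case (insert i J)
  interpret product_sigma_finite "\<lambda>_::'i. gauss v" by (rule product_sigma_finite_gauss [OF v])
  note [measurable] = insert.prems
  note fin = insert.hyps(1,2)
  have upd: "(\<lambda>j\<in>insert i J. (g(i := y)) j + s j) = (\<lambda>j\<in>J. g j + s j)(i := y + s i)" for g y
    using fin by (auto simp: fun_eq_iff)
  define G where "G g = (\<integral>\<^sup>+y. F (g(i := y + s i)) \<partial>gauss v)" for g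
  have G: "G \<in> borel_measurable (PiM J (\<lambda>_. borel))"
    unfolding G_def by measurable
  have G_eq: "G g = (\<integral>\<^sup>+y. F (g(i := y)) * ennreal (shift_density v (s i) y) \<partial>gauss v)"
    if "g \<in> space (PiM J (\<lambda>_. borel :: real measure))" for g
  proof -
    have "(\<lambda>y. F (g(i := y))) \<in> borel_measurable borel"
      using measurable_comp [OF measurable_component_update insert.prems, OF that fin(2)]
      unfolding comp_def .
    from nn_integral_gauss_shift [OF v this] show ?thesis by (simp add: G_def)
  qed
  have "(\<integral>\<^sup>+g. F (\<lambda>j\<in>insert i J. g j + s j) \<partial>PiM (insert i J) (\<lambda>_. gauss v))
      = (\<integral>\<^sup>+g. \<integral>\<^sup>+y. F (\<lambda>j\<in>insert i J. (g(i := y)) j + s j) \<partial>gauss v \<partial>PiM J (\<lambda>_. gauss v))"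
    by (rule product_nn_integral_insert [OF fin]) measurable
  also have "\<dots> = (\<integral>\<^sup>+g. G (\<lambda>j\<in>J. g j + s j) \<partial>PiM J (\<lambda>_. gauss v))"
    by (simp only: upd G_def)
  also have "\<dots> = (\<integral>\<^sup>+g. G g * (\<Prod>j\<in>J. ennreal (shift_density v (s j) (g j))) \<partial>PiM J (\<lambda>_. gauss v))"
    by (rule insert.IH [OF G])
  also have "\<dots> = (\<integral>\<^sup>+g. \<integral>\<^sup>+y. F (g(i := y)) *
      (\<Prod>j\<in>insert i J. ennreal (shift_density v (s j) ((g(i := y)) j))) \<partial>gauss v \<partial>PiM J (\<lambda>_. gauss v))"
  proof (rule nn_integral_cong)
    fix g assume g: "g \<in> space (PiM J (\<lambda>_. gauss v))"
    then have g': "g \<in> space (PiM J (\<lambda>_. borel :: real measure))" by (simp add: space_PiM)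
    have *: "(\<lambda>y. F (g(i := y))) \<in> borel_measurable borel"
      using measurable_comp [OF measurable_component_update insert.prems, OF g' fin(2)]
      unfolding comp_def .
    have pr: "(\<Prod>j\<in>insert i J. ennreal (shift_density v (s j) ((g(i := y)) j)))
        = ennreal (shift_density v (s i) y) * (\<Prod>j\<in>J. ennreal (shift_density v (s j) (g j)))" for y
      using fin by (simp add: fun_upd_def cong: prod.cong) (auto intro!: prod.cong arg_cong2 [where f = "(*)"])
    show "G g * (\<Prod>j\<in>J. ennreal (shift_density v (s j) (g j))) =
      (\<integral>\<^sup>+y. F (g(i := y)) * (\<Prod>j\<in>insert i J. ennreal (shift_density v (s j) ((g(i := y)) j))) \<partial>gauss v)"
      using * by (simp only: pr G_eq [OF g'] mult.assoc [symmetric])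
        (simp add: nn_integral_multc)
  qed
  also have "\<dots> = (\<integral>\<^sup>+g. F g * (\<Prod>j\<in>insert i J. ennreal (shift_density v (s j) (g j)))
      \<partial>PiM (insert i J) (\<lambda>_. gauss v))"
    by (rule product_nn_integral_insert [OF fin, symmetric]) measurable
  finally show ?case .
qed

text \<open>If \<open>L\<close> is the density of the translated measure, then \<open>F L \<le> 2 F + L\<^sup>2 / 8\<close> for \<open>0 \<le> F \<le> 1\<close>, and
the second moment of \<open>L\<close> is the exponential of the squared norm of the translation. Such an
inequality, linear in \<open>F\<close>, survives averaging over a random translation.\<close>

lemma gauss_shift_two_point:
  fixes s :: "'i \<Rightarrow> real"
  assumes v: "0 < v" and J: "finite J"
    and F [measurable]: "F \<in> borel_measurable (PiM J (\<lambda>_. borel :: real measure))"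
    and F1: "\<And>g. F g \<le> 1"
  shows "(\<integral>\<^sup>+g. F (\<lambda>j\<in>J. g j + s j) \<partial>PiM J (\<lambda>_. gauss v))
       \<le> 2 * (\<integral>\<^sup>+g. F g \<partial>PiM J (\<lambda>_. gauss v)) + ennreal (exp ((\<Sum>j\<in>J. (s j)\<^sup>2) / v) / 8)"
proof -
  interpret PJ: prob_space "PiM J (\<lambda>_. gauss v)"
    by (rule prob_space_PiM) (rule prob_space_gauss [OF v])
  define L where "L g = (\<Prod>j\<in>J. shift_density v (s j) (g j))" for g
  have L0: "0 \<le> L g" for g by (auto simp: L_def shift_density_def intro!: prod_nonneg)
  have [measurable]: "L \<in> borel_measurable (PiM J (\<lambda>_. borel :: real measure))"
    unfolding L_def by measurable
  \<comment> \<open>The square of a shift density is, up to a constant, the density of the doubled shift.\<close>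
  have Lsq: "ennreal ((L g)\<^sup>2 / 8) = ennreal (exp ((\<Sum>j\<in>J. (s j)\<^sup>2) / v) / 8) *
      (\<Prod>j\<in>J. ennreal (shift_density v (2 * s j) (g j)))" for g
  proof -
    have "(L g)\<^sup>2 = (\<Prod>j\<in>J. (shift_density v (s j) (g j))\<^sup>2)"
      by (simp add: L_def prod_power_distrib)
    also have "\<dots> = (\<Prod>j\<in>J. exp ((s j)\<^sup>2 / v) * shift_density v (2 * s j) (g j))"
      using v by (intro prod.cong refl)
        (simp add: shift_density_def power2_eq_square exp_add [symmetric] field_simps)
    also have "\<dots> = exp ((\<Sum>j\<in>J. (s j)\<^sup>2) / v) * (\<Prod>j\<in>J. shift_density v (2 * s j) (g j))"
      by (simp add: prod.distrib exp_sum [OF J] sum_divide_distrib)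
    finally have "(L g)\<^sup>2 = exp ((\<Sum>j\<in>J. (s j)\<^sup>2) / v) * (\<Prod>j\<in>J. shift_density v (2 * s j) (g j))" .
    then show ?thesis
      by (simp add: shift_density_def prod_ennreal ennreal_mult [symmetric] prod_nonneg)
  qed
  have pw: "F g * ennreal (L g) \<le> 2 * F g + ennreal ((L g)\<^sup>2 / 8)" for g
  proof -
    obtain a where a: "F g = ennreal a" "0 \<le> a" "a \<le> 1"
      using F1 [of g] by (cases "F g") (auto simp: ennreal_le_1 top_unique)
    have "0 \<le> (4 * a - L g)\<^sup>2" by simp
    moreover have "a\<^sup>2 \<le> a" using a by (simp add: power2_eq_square mult_left_le)
    ultimately have "a * L g \<le> 2 * a + (L g)\<^sup>2 / 8"
      by (simp add: power2_diff power_mult_distrib)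
    then have "ennreal (a * L g) \<le> ennreal (2 * a + (L g)\<^sup>2 / 8)" by (rule ennreal_leI)
    then show ?thesis
      using a L0 [of g] by (simp add: ennreal_mult ennreal_plus)
  qed
  have one: "(\<integral>\<^sup>+g. (\<Prod>j\<in>J. ennreal (shift_density v (2 * s j) (g j))) \<partial>PiM J (\<lambda>_. gauss v)) = 1"
    using nn_integral_PiM_gauss_shift [OF v J, of "\<lambda>_. 1" "\<lambda>j. 2 * s j"] by (simp add: PJ.emeasure_space_1)
  have "(\<integral>\<^sup>+g. F (\<lambda>j\<in>J. g j + s j) \<partial>PiM J (\<lambda>_. gauss v))
      = (\<integral>\<^sup>+g. F g * ennreal (L g) \<partial>PiM J (\<lambda>_. gauss v))"
    unfolding nn_integral_PiM_gauss_shift [OF v J F]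
    by (simp add: L_def prod_ennreal shift_density_def)
  also have "\<dots> \<le> (\<integral>\<^sup>+g. 2 * F g + ennreal ((L g)\<^sup>2 / 8) \<partial>PiM J (\<lambda>_. gauss v))"
    by (intro nn_integral_mono pw)
  also have "\<dots> = 2 * (\<integral>\<^sup>+g. F g \<partial>PiM J (\<lambda>_. gauss v)) + ennreal (exp ((\<Sum>j\<in>J. (s j)\<^sup>2) / v) / 8)"
    unfolding Lsq by (simp add: nn_integral_add nn_integral_cmult one)
  finally show ?thesis .
qed

section \<open>First-order linear recursions and how to steer them\<close>

text \<open>The state of a scalar autoregression driven by the input \<open>u\<close>. Every coordinate of the Euler schemes
below is of this form; since it starts at 0, it is linear in the input.\<close>

primrec ar :: "real \<Rightarrow> (nat \<Rightarrow> real) \<Rightarrow> nat \<Rightarrow> real" where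
  "ar r u 0 = 0"
| "ar r u (Suc k) = r * ar r u k + u k"

lemma ar_cong: "(\<And>j. j < k \<Longrightarrow> u j = v j) \<Longrightarrow> ar r u k = ar r v k"
  by (induction k) auto

lemma ar_add: "ar r (\<lambda>j. u j + v j) k = ar r u k + ar r v k"
  by (induction k) (auto simp: algebra_simps)

lemma ar_cmult: "ar r (\<lambda>j. c * u j) k = c * ar r u k"
  by (induction k) (auto simp: algebra_simps)

lemma ar_nonneg: "0 \<le> r \<Longrightarrow> (\<And>j. 0 \<le> u j) \<Longrightarrow> 0 \<le> ar r u k"
  by (induction k) auto

lemma ar_eq_sum: "ar r u k = (\<Sum>j<k. r ^ (k - 1 - j) * u j)"
proof (induction k)
  case (Suc k)
  have "r * (\<Sum>j<k. r ^ (k - 1 - j) * u j) = (\<Sum>j<k. r ^ (k - j) * u j)"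
    unfolding sum_distrib_left
    by (intro sum.cong refl) (simp add: mult.assoc [symmetric] power_Suc [symmetric] Suc_diff_Suc)
  with Suc show ?case by simp
qed simp

lemma ar_one_le:
  assumes r: "0 \<le> r" "r < 1"
  shows "ar r (\<lambda>_. 1) k \<le> 1 / (1 - r)"
proof (induction k)
  case (Suc k)
  have "ar r (\<lambda>_. 1) (Suc k) \<le> r * (1 / (1 - r)) + 1"
    using mult_left_mono [OF Suc r(1)] by simp
  then show ?case using r by (simp add: field_simps)
qed (use r in simp)

lemma ar_power: "ar r (\<lambda>j. r ^ j) k = real k * r ^ (k - 1)"
proof (induction k)
  case (Suc k)
  then show ?case by (cases k) (auto simp: algebra_simps)
qed simp

text \<open>Convexity of the square: \<open>r a + b\<close> is the average of \<open>a\<close> and \<open>b / (1 - r)\<close> with weights \<open>r\<close> and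
\<open>1 - r\<close>.\<close>

lemma ar_power2_le:
  assumes r: "0 \<le> r" "r < 1"
  shows "(ar r u k)\<^sup>2 \<le> ar r (\<lambda>j. (u j)\<^sup>2) k / (1 - r)"
proof (induction k)
  case (Suc k)
  have *: "(r * a + b)\<^sup>2 \<le> r * a\<^sup>2 + b\<^sup>2 / (1 - r)" for a b :: real
  proof -
    have "0 \<le> r * ((1 - r) * a - b)\<^sup>2" using r by simp
    then have "(1 - r) * (r * a + b)\<^sup>2 \<le> (1 - r) * (r * a\<^sup>2) + b\<^sup>2"
      by (simp add: power2_eq_square algebra_simps)
    with r show ?thesis by (simp add: field_simps)
  qed
  have "(ar r u (Suc k))\<^sup>2 \<le> r * (ar r u k)\<^sup>2 + (u k)\<^sup>2 / (1 - r)"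
    using *[of "ar r u k" "u k"] by simp
  also have "\<dots> \<le> r * (ar r (\<lambda>j. (u j)\<^sup>2) k / (1 - r)) + (u k)\<^sup>2 / (1 - r)"
    using Suc r by (intro add_mono mult_left_mono) auto
  finally show ?case by (simp add: add_divide_distrib)
qed simp

text \<open>An input that reaches the state \<open>ar r w m\<close> at time \<open>m\<close> and follows \<open>w\<close> afterwards. Before time
\<open>m\<close> it is proportional to the weights \<open>r ^ (m - 1 - j)\<close> with which the inputs contribute to that state;
by the Cauchy--Schwarz inequality this is the input of least norm that reaches it.\<close>

definition steer :: "real \<Rightarrow> nat \<Rightarrow> (nat \<Rightarrow> real) \<Rightarrow> nat \<Rightarrow> real" where
  "steer r m w j = (if j < m then ar r w m * r ^ (m - 1 - j) / (\<Sum>i<m. (r\<^sup>2) ^ i) else w j)"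

lemma sum_reversed_power2: "(\<Sum>j<m. (r ^ (m - 1 - j))\<^sup>2) = (\<Sum>i<m. (r\<^sup>2 :: real) ^ i)"
proof -
  have "(\<Sum>i<m. (r\<^sup>2) ^ i) = (\<Sum>j<m. (r\<^sup>2) ^ (m - Suc j))"
    by (rule sum.nat_diff_reindex [symmetric])
  then show ?thesis by (simp add: power_mult [symmetric] mult.commute)
qed

text \<open>From time \<open>m\<close> on, which is all that is observed, the cheap input cannot be told from \<open>w\<close>.\<close>

lemma ar_steer:
  assumes "0 < r" "m \<le> k"
  shows "ar r (steer r m w) k = ar r w k"
proof (cases "m = 0")
  case True
  then have "steer r m w = w" by (simp add: steer_def fun_eq_iff)
  then show ?thesis by simp
next
  case False
  define q where "q = (\<Sum>i<m. (r\<^sup>2) ^ i)"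
  have "0 < q" unfolding q_def using assms False by (intro sum_pos) auto
  have "ar r (steer r m w) m = ar r (\<lambda>j. ar r w m / q * r ^ (m - 1 - j)) m"
    by (rule ar_cong) (simp add: steer_def q_def)
  also have "\<dots> = ar r w m / q * (\<Sum>j<m. (r ^ (m - 1 - j))\<^sup>2)"
    by (simp only: ar_cmult) (simp add: ar_eq_sum power2_eq_square)
  also have "\<dots> = ar r w m"
    unfolding sum_reversed_power2 q_def [symmetric] using \<open>0 < q\<close> by simp
  finally have *: "ar r (steer r m w) m = ar r w m" .
  show ?thesis using \<open>m \<le> k\<close>
  proof (induction k rule: dec_induct)
    case base
    show ?case by (rule *)
  next
    case (step k)
    then show ?case by (simp add: steer_def)
  qed
qed

text \<open>Over the first \<open>m\<close> steps the cost is \<open>ar r w m\<close> squared over the sum of the \<open>r\<^sup>2\<^sup>i\<close>, which is at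
least \<open>1 / (4 (1 - r))\<close> once \<open>r\<^sup>m \<le> 1 / 2\<close>. The resulting bound involves the past of \<open>w\<close> only through
an exponentially discounted sum, hence does not grow with \<open>m\<close>.\<close>

lemma sum_steer_power2:
  assumes r: "0 < r" "r < 1" and m: "r ^ m \<le> 1 / 2" and "m \<le> N"
  shows "(\<Sum>j<N. (steer r m w j)\<^sup>2)
    \<le> 4 * ar r (\<lambda>j. (w j)\<^sup>2) m + (\<Sum>j=m..<N. (w j)\<^sup>2)"
proof -
  define q where "q = (\<Sum>i<m. (r\<^sup>2) ^ i)"
  define W where "W = ar r (\<lambda>j. (w j)\<^sup>2) m"
  have W: "0 \<le> W" unfolding W_def using r by (intro ar_nonneg) auto
  have r2: "r\<^sup>2 < 1" using r by (simp add: power_less_one_iff)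
  have "(1 - r\<^sup>2) * q = 1 - (r\<^sup>2) ^ m"
    unfolding q_def using r2 by (simp add: one_diff_power_eq lessThan_atLeast0)
  moreover have "(r\<^sup>2) ^ m \<le> 1 / 2"
  proof -
    have "(r\<^sup>2) ^ m = r ^ m * r ^ m" by (simp add: power_mult [symmetric] mult_2 power_add)
    also have "\<dots> \<le> 1 / 2 * 1" using r m by (intro mult_mono) (auto simp: power_le_one)
    finally show ?thesis by simp
  qed
  ultimately have "1 / 2 \<le> (1 - r\<^sup>2) * q" by simp
  moreover have "1 - r\<^sup>2 \<le> 2 * (1 - r)"
    using zero_le_power2 [of "1 - r"] by (simp add: power2_eq_square algebra_simps)
  moreover have "0 \<le> q" unfolding q_def using r by (intro sum_nonneg) auto
  ultimately have "1 / 2 \<le> 2 * (1 - r) * q"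
    using mult_right_mono [of "1 - r\<^sup>2" "2 * (1 - r)" q] by linarith
  then have q: "1 \<le> 4 * (1 - r) * q" by (simp add: algebra_simps)
  have q0: "0 < q" using q \<open>0 \<le> q\<close> by (cases "q = 0") simp_all
  have "(\<Sum>j<m. (steer r m w j)\<^sup>2) = (\<Sum>j<m. (ar r w m / q)\<^sup>2 * (r ^ (m - 1 - j))\<^sup>2)"
    by (intro sum.cong) (auto simp: steer_def q_def power_mult_distrib power_divide)
  also have "\<dots> = (ar r w m / q)\<^sup>2 * q"
    by (simp only: sum_distrib_left [symmetric] sum_reversed_power2 q_def)
  also have "\<dots> = (ar r w m)\<^sup>2 / q"
    using q0 by (simp add: power2_eq_square)
  also have "\<dots> \<le> W / (1 - r) / q"
    using ar_power2_le [of r w m] r q0 by (intro divide_right_mono) (auto simp: W_def)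
  also have "\<dots> \<le> 4 * W"
  proof -
    have "W * 1 \<le> W * (4 * (1 - r) * q)" using W q by (intro mult_left_mono)
    then show ?thesis using r q0 by (simp add: field_simps)
  qed
  finally have "(\<Sum>j<m. (steer r m w j)\<^sup>2) \<le> 4 * W" .
  moreover have "(\<Sum>j<N. (steer r m w j)\<^sup>2)
      = (\<Sum>j<m. (steer r m w j)\<^sup>2) + (\<Sum>j=m..<N. (steer r m w j)\<^sup>2)"
    using \<open>m \<le> N\<close> by (simp add: lessThan_atLeast0 sum.atLeastLessThan_concat)
  moreover have "(\<Sum>j=m..<N. (steer r m w j)\<^sup>2) = (\<Sum>j=m..<N. (w j)\<^sup>2)"
    by (intro sum.cong) (auto simp: steer_def)
  ultimately show ?thesis by (simp add: W_def)
qed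

section \<open>Second moments under Gaussian product measures\<close>

text \<open>The bound \<open>c / (1 - r)\<close> is the fixed point of \<open>x \<mapsto> r x + c\<close>.\<close>

lemma nn_integral_ar_le:
  assumes r: "0 \<le> r" "r < 1" and c: "0 \<le> c"
    and [measurable]: "\<And>j. j < m \<Longrightarrow> u j \<in> borel_measurable M"
    and u0: "\<And>j x. 0 \<le> u j x"
    and u: "\<And>j. j < m \<Longrightarrow> (\<integral>\<^sup>+x. ennreal (u j x) \<partial>M) \<le> ennreal c"
  shows "(\<lambda>x. ar r (\<lambda>j. u j x) m) \<in> borel_measurable M \<and>
    (\<integral>\<^sup>+x. ennreal (ar r (\<lambda>j. u j x) m) \<partial>M) \<le> ennreal (c / (1 - r))"
  using assms(4,6)
proof (induction m)
  case (Suc m)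
  then have [measurable]: "(\<lambda>x. ar r (\<lambda>j. u j x) m) \<in> borel_measurable M"
    and um [measurable]: "u m \<in> borel_measurable M"
    and IH: "(\<integral>\<^sup>+x. ennreal (ar r (\<lambda>j. u j x) m) \<partial>M) \<le> ennreal (c / (1 - r))" by auto
  have "(\<integral>\<^sup>+x. ennreal (ar r (\<lambda>j. u j x) (Suc m)) \<partial>M)
      = ennreal r * (\<integral>\<^sup>+x. ennreal (ar r (\<lambda>j. u j x) m) \<partial>M) + (\<integral>\<^sup>+x. ennreal (u m x) \<partial>M)"
    using r by (simp add: ennreal_plus ennreal_mult ar_nonneg u0 nn_integral_add nn_integral_cmult)
  also have "\<dots> \<le> ennreal r * ennreal (c / (1 - r)) + ennreal c"
    using IH Suc.prems(2) [of m] by (intro add_mono mult_left_mono) auto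
  also have "\<dots> = ennreal (r * (c / (1 - r)) + c)"
    using r c by (subst ennreal_plus, simp, simp, subst ennreal_mult, auto)
  also have "r * (c / (1 - r)) + c = c / (1 - r)"
    using r by (simp add: field_simps)
  finally show ?case by simp
qed simp

lemma gauss_moments:
  assumes v: "0 < v"
  shows "integrable (gauss v) (\<lambda>x. x)" "integral\<^sup>L (gauss v) (\<lambda>x. x) = 0"
    "integrable (gauss v) (\<lambda>x. x * x)" "integral\<^sup>L (gauss v) (\<lambda>x. x * x) = v"
proof -
  have s: "0 < sqrt v" using v by simp
  show "integrable (gauss v) (\<lambda>x. x)" "integral\<^sup>L (gauss v) (\<lambda>x. x) = 0"
    using integrable_normal_moment [OF s, of 0 1] integral_normal_moment_odd [OF s, of 0 0]
    by (simp_all add: gauss_def integrable_density integral_density)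
  show "integrable (gauss v) (\<lambda>x. x * x)" "integral\<^sup>L (gauss v) (\<lambda>x. x * x) = v"
    using integrable_normal_moment [OF s, of 0 2] integral_normal_moment_even [OF s, of 0 1] v
    by (simp_all add: gauss_def integrable_density integral_density power2_eq_square)
qed

text \<open>The integrand is written as a product over all coordinates, most factors being 1, so that the
integral factorizes.\<close>

lemma integral_PiM_gauss_mult:
  fixes i j :: 'i
  assumes v: "0 < v" and J: "finite J" "i \<in> J" "j \<in> J"
  shows "integrable (PiM J (\<lambda>_. gauss v)) (\<lambda>g. g i * g j)"
    and "(\<integral>g. g i * g j \<partial>PiM J (\<lambda>_. gauss v)) = (if i = j then v else 0)"
proof -
  interpret product_sigma_finite "\<lambda>_::'i. gauss v" by (rule product_sigma_finite_gauss [OF v])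
  define f where "f k x = (if k = i then x else 1) * (if k = j then x else (1::real))" for k x
  interpret pg: prob_space "gauss v" by (rule prob_space_gauss [OF v])
  have f: "integrable (gauss v) (f k)" for k
  proof (cases "k = i \<or> k = j")
    case True
    then have "f k = (\<lambda>x. x) \<or> f k = (\<lambda>x. x * x)"
      by (cases "i = j") (auto simp: f_def [abs_def])
    then show ?thesis using gauss_moments(1,3) [OF v] by metis
  next
    case False
    then have "f k = (\<lambda>_. 1)" by (auto simp: f_def)
    then show ?thesis by simp
  qed
  have eq: "g i * g j = (\<Prod>k\<in>J. f k (g k))" for g
    using J by (simp add: f_def prod.distrib)
  show "integrable (PiM J (\<lambda>_. gauss v)) (\<lambda>g. g i * g j)"
    unfolding eq by (rule product_integrable_prod) (use J f in auto)
  have "(\<integral>g. g i * g j \<partial>PiM J (\<lambda>_. gauss v)) = (\<Prod>k\<in>J. integral\<^sup>L (gauss v) (f k))"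
    unfolding eq by (rule product_integral_prod) (use J f in auto)
  also have "\<dots> = (if i = j then v else 0)"
  proof (cases "i = j")
    case True
    have "integral\<^sup>L (gauss v) (f k) = (if k = i then v else 1)" for k
    proof (cases "k = i")
      case True
      then have "f k = (\<lambda>x. x * x)" using \<open>i = j\<close> by (simp add: f_def [abs_def])
      then show ?thesis using True gauss_moments(4) [OF v] by simp
    next
      case False
      then have "f k = (\<lambda>_. 1)" using \<open>i = j\<close> by (simp add: f_def [abs_def])
      then show ?thesis using False pg.prob_space by simp
    qed
    then show ?thesis using True J by simp
  next
    case False
    have "integral\<^sup>L (gauss v) (f i) = 0"
      using gauss_moments(2) [OF v] False by (simp add: f_def [abs_def])
    then have "(\<Prod>k\<in>J. integral\<^sup>L (gauss v) (f k)) = 0"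
      using J by (intro prod_zero) auto
    with False show ?thesis by simp
  qed
  finally show "(\<integral>g. g i * g j \<partial>PiM J (\<lambda>_. gauss v)) = (if i = j then v else 0)" .
qed

lemma nn_integral_PiM_gauss_sum_power2:
  fixes c :: "'i \<Rightarrow> real"
  assumes v: "0 < v" and J: "finite J" "K \<subseteq> J"
  shows "(\<integral>\<^sup>+g. ennreal ((\<Sum>j\<in>K. c j * g j)\<^sup>2) \<partial>PiM J (\<lambda>_. gauss v)) = ennreal (v * (\<Sum>j\<in>K. (c j)\<^sup>2))"
proof -
  have mult: "integrable (PiM J (\<lambda>_. gauss v)) (\<lambda>g. g i * g j)"
    "(\<integral>g. g i * g j \<partial>PiM J (\<lambda>_. gauss v)) = (if i = j then v else 0)" if "i \<in> K" "j \<in> K" for i j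
    using integral_PiM_gauss_mult [OF v J(1), of i j] subsetD [OF J(2) that(1)] subsetD [OF J(2) that(2)]
    by simp_all
  have [simp]: "finite K" using J finite_subset by auto
  have eq: "(\<Sum>j\<in>K. c j * g j)\<^sup>2 = (\<Sum>i\<in>K. \<Sum>j\<in>K. c i * c j * (g i * g j))" for g
    by (simp add: power2_eq_square sum_product mult_ac)
  have int: "integrable (PiM J (\<lambda>_. gauss v)) (\<lambda>g. (\<Sum>j\<in>K. c j * g j)\<^sup>2)"
    unfolding eq by (intro Bochner_Integration.integrable_sum integrable_mult_right mult)
  have "(\<integral>g. (\<Sum>j\<in>K. c j * g j)\<^sup>2 \<partial>PiM J (\<lambda>_. gauss v))
      = (\<Sum>i\<in>K. \<Sum>j\<in>K. c i * c j * (if i = j then v else 0))"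
  proof -
    have "(\<integral>g. (\<Sum>j\<in>K. c i * c j * (g i * g j)) \<partial>PiM J (\<lambda>_. gauss v))
        = (\<Sum>j\<in>K. c i * c j * (if i = j then v else 0))" if "i \<in> K" for i
      using mult that by (subst Bochner_Integration.integral_sum) (auto intro!: sum.cong)
    then show ?thesis
      unfolding eq using mult
      by (subst Bochner_Integration.integral_sum)
        (auto intro!: sum.cong Bochner_Integration.integrable_sum)
  qed
  also have "\<dots> = v * (\<Sum>j\<in>K. (c j)\<^sup>2)"
    by (simp add: power2_eq_square sum_distrib_left mult_ac if_distrib [of "(*) _"] cong: if_cong)
  finally show ?thesis
    using nn_integral_eq_integral [OF int] by simp
qed

section \<open>The Euler scheme under two drifts\<close>

text \<open>The Euler scheme for the drift \<open>\<lambda> Id + \<delta> E\<^sub>0\<^sub>1\<close> with step \<open>1 / n\<close>, started at 0: \<open>r = 1 - \<lambda> / n\<close>,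
\<open>e = \<delta> / n\<close>, and \<open>g (k, i)\<close> is the \<open>k\<close>-th noise increment of coordinate \<open>i\<close>.\<close>

definition euler :: "real \<Rightarrow> real \<Rightarrow> (nat \<times> nat \<Rightarrow> real) \<Rightarrow> nat \<Rightarrow> nat \<Rightarrow> real" where
  "euler r e g k i =
     ar r (\<lambda>j. g (j, i) - (if i = 0 then e * ar r (\<lambda>l. g (l, 1)) j else 0)) k"

text \<open>The Euler scheme as a path over \<open>I\<close>, time \<open>t\<close> being represented by the grid point \<open>\<kappa> t\<close>.\<close>

definition euler_path ::
    "nat \<Rightarrow> real set \<Rightarrow> (real \<Rightarrow> nat) \<Rightarrow> real \<Rightarrow> real \<Rightarrow> (nat \<times> nat \<Rightarrow> real) \<Rightarrow> real \<Rightarrow> nat \<Rightarrow> real" where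
  "euler_path d I \<kappa> r e g = (\<lambda>t\<in>I. \<lambda>i\<in>{..<d}. euler r e g (\<kappa> t) i)"

lemma measurable_ar:
  "(\<And>j. j < k \<Longrightarrow> u j \<in> borel_measurable M) \<Longrightarrow> (\<lambda>x. ar r (\<lambda>j. u j x) k) \<in> borel_measurable M"
  by (induction k) auto

lemma measurable_euler:
  assumes "k \<le> N" "i < d" "2 \<le> d"
  shows "(\<lambda>g. euler r e g k i) \<in> borel_measurable (PiM ({..<N} \<times> {..<d}) (\<lambda>_. borel))"
proof -
  have 1: "(\<lambda>g. g (j, i) :: real) \<in> borel_measurable (PiM ({..<N} \<times> {..<d}) (\<lambda>_. borel))"
    if "j < N" "i < d" for i j
    using that by (intro measurable_component_singleton) auto
  show ?thesis
    unfolding euler_def using assms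
    by (cases "i = 0") (auto intro!: measurable_ar borel_measurable_diff borel_measurable_times 1)
qed

lemma measurable_euler_path:
  assumes "\<And>t. t \<in> I \<Longrightarrow> \<kappa> t \<le> N" "2 \<le> d"
  shows "euler_path d I \<kappa> r e \<in> PiM ({..<N} \<times> {..<d}) (\<lambda>_. borel) \<rightarrow>\<^sub>M path_space d I"
  unfolding euler_path_def [abs_def] path_space_def state_space_def
  using assms by (intro measurable_restrict measurable_euler) auto

text \<open>Split the noise into that of coordinate 0 (\<open>B\<close>) and the rest (\<open>A\<close>). For fixed rest, the coupling
\<open>e\<close> adds the deterministic input \<open>w\<close> to coordinate 0; on the observed grid points \<open>m..N\<close> the input
\<open>steer r m w\<close> has the same effect, so the two schemes differ by a translation of the noise in
\<open>B\<close>. If its cost exceeds the variance \<open>v\<close>, the left-hand side is trivially at most the cost divided by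
\<open>v\<close>; otherwise \<open>gauss_shift_two_point\<close> applies. It remains to average the cost over the rest.\<close>

lemma euler_two_point:
  fixes f :: "(real \<Rightarrow> nat \<Rightarrow> real) \<Rightarrow> ennreal"
  assumes v: "0 < v" and r: "0 < r" "r < 1" and m: "r ^ m \<le> 1 / 2" and d: "2 \<le> d"
    and \<kappa>: "\<And>t. t \<in> I \<Longrightarrow> m \<le> \<kappa> t \<and> \<kappa> t \<le> N" and mN: "m \<le> N"
    and f [measurable]: "f \<in> borel_measurable (path_space d I)" and f1: "\<And>x. f x \<le> 1"
  shows "(\<integral>\<^sup>+g. f (euler_path d I \<kappa> r e g) \<partial>PiM ({..<N} \<times> {..<d}) (\<lambda>_. gauss v))
    \<le> 2 * (\<integral>\<^sup>+g. f (euler_path d I \<kappa> r 0 g) \<partial>PiM ({..<N} \<times> {..<d}) (\<lambda>_. gauss v))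
      + ennreal (exp 1 / 8) + ennreal (e\<^sup>2 * (4 / (1 - r)\<^sup>2 + real (N - m) / (1 - r)))"
proof -
  define A where "A = {..<N} \<times> {1..<d}"
  define B where "B = {..<N} \<times> {0::nat}"
  have AB: "A \<inter> B = {}" "finite A" "finite B" and Un: "A \<union> B = {..<N} \<times> {..<d}"
    using d by (auto simp: A_def B_def)
  interpret product_sigma_finite "\<lambda>_::nat \<times> nat. gauss v" by (rule product_sigma_finite_gauss [OF v])
  interpret PA: prob_space "PiM A (\<lambda>_. gauss v)"
    by (rule prob_space_PiM) (rule prob_space_gauss [OF v])
  interpret PB: prob_space "PiM B (\<lambda>_. gauss v)"
    by (rule prob_space_PiM) (rule prob_space_gauss [OF v])
  have me [measurable]: "(\<lambda>g. f (euler_path d I \<kappa> r e g)) \<in> borel_measurable (PiM (A \<union> B) (\<lambda>_. borel))" for e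
    unfolding Un using \<kappa> d by (intro measurable_compose [OF measurable_euler_path f]) auto
  have me' [measurable]: "(\<lambda>g. f (euler_path d I \<kappa> r e g)) \<in> borel_measurable (PiM (A \<union> B) (\<lambda>_. gauss v))" for e
    using me by (simp cong: measurable_cong_sets sets_PiM_cong)
  define w where "w x j = - e * ar r (\<lambda>l. x (l, 1)) j" for x :: "nat \<times> nat \<Rightarrow> real" and j
  define cost where "cost x = 4 * ar r (\<lambda>j. (w x j)\<^sup>2) m + (\<Sum>j=m..<N. (w x j)\<^sup>2)" for x
  have cost0: "0 \<le> cost x" for x
    unfolding cost_def using r by (intro add_nonneg_nonneg mult_nonneg_nonneg ar_nonneg sum_nonneg) auto

  have inner: "(\<integral>\<^sup>+y. f (euler_path d I \<kappa> r e (merge A B (x, y))) \<partial>PiM B (\<lambda>_. gauss v))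
      \<le> 2 * (\<integral>\<^sup>+y. f (euler_path d I \<kappa> r 0 (merge A B (x, y))) \<partial>PiM B (\<lambda>_. gauss v))
        + ennreal (exp 1 / 8) + ennreal (cost x / v)"
    if x: "x \<in> space (PiM A (\<lambda>_. borel))" for x
  proof (cases "cost x / v \<le> 1")
    case False
    have "(\<integral>\<^sup>+y. f (euler_path d I \<kappa> r e (merge A B (x, y))) \<partial>PiM B (\<lambda>_. gauss v))
        \<le> (\<integral>\<^sup>+y. 1 \<partial>PiM B (\<lambda>_. gauss v))"
      by (intro nn_integral_mono f1)
    also have "\<dots> = ennreal 1" by (simp add: PB.emeasure_space_1)
    also have "\<dots> \<le> ennreal (cost x / v)" using False by (intro ennreal_leI) auto
    also have "\<dots> \<le> 2 * (\<integral>\<^sup>+y. f (euler_path d I \<kappa> r 0 (merge A B (x, y))) \<partial>PiM B (\<lambda>_. gauss v))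
        + ennreal (exp 1 / 8) + ennreal (cost x / v)"
      by simp
    finally show ?thesis .
  next
    case True
    define s where "s p = steer r m (w x) (fst p)" for p :: "nat \<times> nat"
    define F where "F y = f (euler_path d I \<kappa> r 0 (merge A B (x, y)))" for y
    have F: "F \<in> borel_measurable (PiM B (\<lambda>_. borel))"
      unfolding F_def
      by (rule measurable_compose [OF _ me]) (use x in measurable)
    have shift: "euler r e (merge A B (x, y)) k i = euler r 0 (merge A B (x, \<lambda>p\<in>B. y p + s p)) k i"
      if k: "m \<le> k" "k \<le> N" and i: "i < d" for y k i
    proof (cases "i = 0")
      case False
      then show ?thesis
        unfolding euler_def using k i by (intro ar_cong) (auto simp: merge_def A_def)
    next
      case True
      have "euler r e (merge A B (x, y)) k i = ar r (\<lambda>j. y (j, 0) + w x j) k"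
        unfolding euler_def using k i d True
        by (intro ar_cong) (auto simp: merge_def A_def B_def w_def intro!: arg_cong2 [where f = "(*)"] ar_cong)
      also have "\<dots> = ar r (\<lambda>j. y (j, 0) + steer r m (w x) j) k"
        using r k by (simp only: ar_add ar_steer)
      also have "\<dots> = euler r 0 (merge A B (x, \<lambda>p\<in>B. y p + s p)) k i"
        unfolding euler_def using k i d True
        by (intro ar_cong) (auto simp: merge_def A_def B_def s_def)
      finally show ?thesis .
    qed
    have "euler_path d I \<kappa> r e (merge A B (x, y)) = euler_path d I \<kappa> r 0 (merge A B (x, \<lambda>p\<in>B. y p + s p))" for y
      unfolding euler_path_def using \<kappa> by (intro restrict_ext shift) auto
    then have "(\<integral>\<^sup>+y. f (euler_path d I \<kappa> r e (merge A B (x, y))) \<partial>PiM B (\<lambda>_. gauss v))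
        = (\<integral>\<^sup>+y. F (\<lambda>p\<in>B. y p + s p) \<partial>PiM B (\<lambda>_. gauss v))"
      by (simp add: F_def)
    also have "\<dots> \<le> 2 * (\<integral>\<^sup>+y. F y \<partial>PiM B (\<lambda>_. gauss v)) + ennreal (exp ((\<Sum>p\<in>B. (s p)\<^sup>2) / v) / 8)"
      by (rule gauss_shift_two_point [OF v AB(3) F]) (simp add: F_def f1)
    also have "\<dots> \<le> 2 * (\<integral>\<^sup>+y. F y \<partial>PiM B (\<lambda>_. gauss v)) + ennreal (exp 1 / 8)"
    proof -
      have "(\<Sum>p\<in>B. (s p)\<^sup>2) = (\<Sum>j<N. (steer r m (w x) j)\<^sup>2)"
        by (rule sum.reindex_bij_witness [of _ "\<lambda>j. (j, 0)" fst]) (auto simp: B_def s_def)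
      also have "\<dots> \<le> cost x"
        unfolding cost_def by (rule sum_steer_power2 [OF r m mN])
      finally have "(\<Sum>p\<in>B. (s p)\<^sup>2) / v \<le> 1"
        using True v by (meson divide_right_mono less_imp_le order_trans)
      then show ?thesis by (intro add_left_mono ennreal_leI) simp
    qed
    also have "\<dots> \<le> 2 * (\<integral>\<^sup>+y. F y \<partial>PiM B (\<lambda>_. gauss v)) + ennreal (exp 1 / 8) + ennreal (cost x / v)"
      by simp
    finally show ?thesis unfolding F_def .
  qed

  have compA: "(\<lambda>x. x (l, 1) :: real) \<in> borel_measurable (PiM A (\<lambda>_. gauss v))" if "l < N" for l
    using that d by (auto simp: A_def intro!: measurable_component_singleton)
  have wm: "(\<lambda>x. (w x j)\<^sup>2) \<in> borel_measurable (PiM A (\<lambda>_. gauss v))" if "j \<le> N" for j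
    unfolding w_def using that by (intro borel_measurable_power borel_measurable_times measurable_ar compA) auto
  \<comment> \<open>Orthogonality of the increments bounds the variance of coordinate 1 by \<open>v / (1 - r)\<close>, which does
     not depend on the mesh, as both \<open>v\<close> and \<open>1 - r\<close> are proportional to it.\<close>
  have w2: "(\<integral>\<^sup>+x. ennreal ((w x j)\<^sup>2) \<partial>PiM A (\<lambda>_. gauss v)) \<le> ennreal (e\<^sup>2 * v / (1 - r))"
    if "j \<le> N" for j
  proof -
    define c where "c p = r ^ (j - 1 - fst p)" for p :: "nat \<times> nat"
    have K: "{..<j} \<times> {1} \<subseteq> A" using that d by (auto simp: A_def)
    have w_eq: "(w x j)\<^sup>2 = e\<^sup>2 * (\<Sum>p\<in>{..<j} \<times> {1}. c p * x p)\<^sup>2" for x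
    proof -
      have "ar r (\<lambda>l. x (l, 1)) j = (\<Sum>p\<in>{..<j} \<times> {1}. c p * x p)"
        unfolding ar_eq_sum
        by (rule sum.reindex_bij_witness [of _ fst "\<lambda>l. (l, 1)"]) (auto simp: c_def)
      then show ?thesis by (simp add: w_def power_mult_distrib)
    qed
    have cm: "(\<lambda>x. \<Sum>p\<in>{..<j} \<times> {1}. c p * x p) \<in> borel_measurable (PiM A (\<lambda>_. gauss v))"
      using that by (intro borel_measurable_sum borel_measurable_times) (auto intro!: compA [simplified])
    have "(\<Sum>p\<in>{..<j} \<times> {1}. (c p)\<^sup>2) = (\<Sum>l<j. (r ^ (j - 1 - l))\<^sup>2)"
      by (rule sum.reindex_bij_witness [of _ "\<lambda>l. (l, 1)" fst]) (auto simp: c_def)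
    also have "\<dots> \<le> (\<Sum>l<j. r ^ (j - 1 - l) * 1)"
      using r by (intro sum_mono) (simp add: power2_eq_square mult_left_le power_le_one)
    also have "\<dots> = ar r (\<lambda>_. 1) j" by (simp only: ar_eq_sum)
    also have "\<dots> \<le> 1 / (1 - r)" using r by (intro ar_one_le) auto
    finally have c2: "(\<Sum>p\<in>{..<j} \<times> {1}. (c p)\<^sup>2) \<le> 1 / (1 - r)" .
    have "(\<integral>\<^sup>+x. ennreal ((w x j)\<^sup>2) \<partial>PiM A (\<lambda>_. gauss v))
        = ennreal (e\<^sup>2) * ennreal (v * (\<Sum>p\<in>{..<j} \<times> {1}. (c p)\<^sup>2))"
      unfolding w_eq using cm
      by (simp add: ennreal_mult nn_integral_cmult nn_integral_PiM_gauss_sum_power2 [OF v AB(2) K]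
          del: One_nat_def)
    also have "\<dots> = ennreal (e\<^sup>2 * (v * (\<Sum>p\<in>{..<j} \<times> {1}. (c p)\<^sup>2)))"
      using v by (simp add: ennreal_mult sum_nonneg)
    also have "\<dots> \<le> ennreal (e\<^sup>2 * (v * (1 / (1 - r))))"
      using c2 v by (intro ennreal_leI mult_left_mono) auto
    finally show ?thesis by simp
  qed
  define b where "b = e\<^sup>2 * v / (1 - r)"
  have b0: "0 \<le> b" using v r by (simp add: b_def)
  have arw: "(\<lambda>x. ar r (\<lambda>j. (w x j)\<^sup>2) m) \<in> borel_measurable (PiM A (\<lambda>_. gauss v))"
    "(\<integral>\<^sup>+x. ennreal (ar r (\<lambda>j. (w x j)\<^sup>2) m) \<partial>PiM A (\<lambda>_. gauss v)) \<le> ennreal (b / (1 - r))"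
    using nn_integral_ar_le [of r b m "\<lambda>j x. (w x j)\<^sup>2" "PiM A (\<lambda>_. gauss v)"] r b0 wm w2 mN
    by (auto simp: b_def)
  have costm: "cost \<in> borel_measurable (PiM A (\<lambda>_. gauss v))"
    unfolding cost_def [abs_def] using arw(1) wm by (intro borel_measurable_add borel_measurable_times
      borel_measurable_sum) auto
  have Ecost: "(\<integral>\<^sup>+x. ennreal (cost x / v) \<partial>PiM A (\<lambda>_. gauss v))
      \<le> ennreal (e\<^sup>2 * (4 / (1 - r)\<^sup>2 + real (N - m) / (1 - r)))"
  proof -
    have ar0: "0 \<le> ar r (\<lambda>j. (w x j)\<^sup>2) m" for x using r by (intro ar_nonneg) auto
    have "(\<integral>\<^sup>+x. ennreal (cost x) \<partial>PiM A (\<lambda>_. gauss v))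
        = (\<integral>\<^sup>+x. 4 * ennreal (ar r (\<lambda>j. (w x j)\<^sup>2) m) + (\<Sum>j=m..<N. ennreal ((w x j)\<^sup>2)) \<partial>PiM A (\<lambda>_. gauss v))"
      using ar0 by (simp add: cost_def ennreal_plus ennreal_mult sum_nonneg)
    also have "\<dots> = 4 * (\<integral>\<^sup>+x. ennreal (ar r (\<lambda>j. (w x j)\<^sup>2) m) \<partial>PiM A (\<lambda>_. gauss v))
        + (\<Sum>j=m..<N. \<integral>\<^sup>+x. ennreal ((w x j)\<^sup>2) \<partial>PiM A (\<lambda>_. gauss v))"
    proof -
      have "(\<integral>\<^sup>+x. (\<Sum>j=m..<N. ennreal ((w x j)\<^sup>2)) \<partial>PiM A (\<lambda>_. gauss v))
          = (\<Sum>j=m..<N. \<integral>\<^sup>+x. ennreal ((w x j)\<^sup>2) \<partial>PiM A (\<lambda>_. gauss v))"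
        using wm by (intro nn_integral_sum) auto
      moreover have "(\<lambda>x. \<Sum>j=m..<N. ennreal ((w x j)\<^sup>2)) \<in> borel_measurable (PiM A (\<lambda>_. gauss v))"
        using wm by (intro borel_measurable_sum measurable_compose [OF _ measurable_ennreal]) auto
      ultimately show ?thesis
        using arw(1) by (simp add: nn_integral_add nn_integral_cmult del: sum_ennreal)
    qed
    also have "\<dots> \<le> 4 * ennreal (b / (1 - r)) + (\<Sum>j=m..<N. ennreal b)"
      using arw(2) w2 by (intro add_mono mult_left_mono sum_mono) (auto simp: b_def)
    also have "\<dots> = ennreal (4 * (b / (1 - r)) + real (N - m) * b)"
    proof -
      have "4 * ennreal (b / (1 - r)) = ennreal (4 * (b / (1 - r)))"
        using b0 r by (subst ennreal_mult) auto
      moreover have "(\<Sum>j=m..<N. ennreal b) = ennreal (real (N - m) * b)"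
        using b0 by (subst ennreal_mult) (auto simp: ennreal_of_nat_eq_real_of_nat)
      ultimately show ?thesis using b0 r by (subst ennreal_plus) auto
    qed
    finally have *: "(\<integral>\<^sup>+x. ennreal (cost x) \<partial>PiM A (\<lambda>_. gauss v))
        \<le> ennreal (4 * (b / (1 - r)) + real (N - m) * b)" .
    have "(\<integral>\<^sup>+x. ennreal (cost x / v) \<partial>PiM A (\<lambda>_. gauss v))
        = ennreal (1 / v) * (\<integral>\<^sup>+x. ennreal (cost x) \<partial>PiM A (\<lambda>_. gauss v))"
      using costm v cost0 by (subst nn_integral_cmult [symmetric])
        (auto simp: ennreal_mult [symmetric])
    also have "\<dots> \<le> ennreal (1 / v) * ennreal (4 * (b / (1 - r)) + real (N - m) * b)"
      by (intro mult_left_mono *) auto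
    also have "\<dots> = ennreal (1 / v * (4 * (b / (1 - r)) + real (N - m) * b))"
      using v b0 r by (subst ennreal_mult) auto
    also have "1 / v * (4 * (b / (1 - r)) + real (N - m) * b)
        = e\<^sup>2 * (4 / (1 - r)\<^sup>2 + real (N - m) / (1 - r))"
      using v r by (simp add: b_def field_simps power2_eq_square)
    finally show ?thesis .
  qed

  have fold: "(\<integral>\<^sup>+g. f (euler_path d I \<kappa> r e g) \<partial>PiM ({..<N} \<times> {..<d}) (\<lambda>_. gauss v))
    = (\<integral>\<^sup>+x. \<integral>\<^sup>+y. f (euler_path d I \<kappa> r e (merge A B (x, y))) \<partial>PiM B (\<lambda>_. gauss v) \<partial>PiM A (\<lambda>_. gauss v))" for e
    unfolding Un [symmetric] by (rule product_nn_integral_fold [OF AB me'])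
  have im: "(\<lambda>x. \<integral>\<^sup>+y. f (euler_path d I \<kappa> r e (merge A B (x, y))) \<partial>PiM B (\<lambda>_. gauss v))
      \<in> borel_measurable (PiM A (\<lambda>_. gauss v))" for e
    by (intro PB.borel_measurable_nn_integral measurable_compose [OF _ me'])
      (simp add: case_prod_beta')
  have "(\<integral>\<^sup>+g. f (euler_path d I \<kappa> r e g) \<partial>PiM ({..<N} \<times> {..<d}) (\<lambda>_. gauss v))
    \<le> (\<integral>\<^sup>+x. 2 * (\<integral>\<^sup>+y. f (euler_path d I \<kappa> r 0 (merge A B (x, y))) \<partial>PiM B (\<lambda>_. gauss v))
        + ennreal (exp 1 / 8) + ennreal (cost x / v) \<partial>PiM A (\<lambda>_. gauss v))"
    unfolding fold by (intro nn_integral_mono inner) (simp add: space_PiM)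
  also have "\<dots> = 2 * (\<integral>\<^sup>+g. f (euler_path d I \<kappa> r 0 g) \<partial>PiM ({..<N} \<times> {..<d}) (\<lambda>_. gauss v))
      + ennreal (exp 1 / 8) + (\<integral>\<^sup>+x. ennreal (cost x / v) \<partial>PiM A (\<lambda>_. gauss v))"
    unfolding fold using im costm by (simp add: nn_integral_add nn_integral_cmult PA.emeasure_space_1)
  finally show ?thesis
    using Ecost by (meson add_left_mono order_trans)
qed

section \<open>The increments of a Wiener process on a grid\<close>

text \<open>The first \<open>N\<close> increments of \<open>Z\<close> over the grid of mesh \<open>1 / n\<close>, flattened to one finite index set so
that a single coordinate of the state space can be split off later.\<close>

definition noise :: "nat \<Rightarrow> nat \<Rightarrow> nat \<Rightarrow> (real \<Rightarrow> 'w \<Rightarrow> nat \<Rightarrow> real) \<Rightarrow> 'w \<Rightarrow> nat \<times> nat \<Rightarrow> real" where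
  "noise d n N Z w = (\<lambda>p\<in>{..<N} \<times> {..<d}.
     Z (real (Suc (fst p)) / real n) w (snd p) - Z (real (fst p) / real n) w (snd p))"

lemma measurable_state_component:
  assumes "Y \<in> M \<rightarrow>\<^sub>M state_space d" "i < d"
  shows "(\<lambda>w. Y w i) \<in> borel_measurable M"
  using measurable_compose [OF assms(1), of "\<lambda>x. x i" borel] assms(2)
  by (simp add: state_space_def)

lemma measurable_noise:
  assumes "stochastic_process d M Z"
  shows "noise d n N Z \<in> M \<rightarrow>\<^sub>M PiM ({..<N} \<times> {..<d}) (\<lambda>_. borel)"
proof -
  have "(\<lambda>w. Z t w i) \<in> borel_measurable M" if "0 \<le> t" "i < d" for t i
    using assms that by (intro measurable_state_component) (auto simp: stochastic_process_def)
  then show ?thesis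
    unfolding noise_def [abs_def] by (intro measurable_restrict borel_measurable_diff) auto
qed

text \<open>Both measures agree on boxes: independence of the increments factorizes over the time steps, and
the law of one increment factorizes over the coordinates.\<close>

lemma distr_noise:
  assumes wiener: "standard_wiener d M Z" and n: "0 < n" and N: "0 < N"
  shows "distr M (PiM ({..<N} \<times> {..<d}) (\<lambda>_. borel)) (noise d n N Z)
       = PiM ({..<N} \<times> {..<d}) (\<lambda>_. gauss (1 / real n))"
proof -
  define v where "v = 1 / real n"
  have v: "0 < v" using n by (simp add: v_def)
  define tt where "tt k = real k / real n" for k
  define inc where "inc k = increment d Z (tt k) (tt (Suc k))" for k
  have sp: "stochastic_process d M Z" using wiener by (simp add: standard_wiener_def)
  interpret prob_space M using sp by (simp add: stochastic_process_def)
  interpret G: product_sigma_finite "\<lambda>_::nat. gauss v" by (rule product_sigma_finite_gauss [OF v])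
  interpret GG: product_sigma_finite "\<lambda>_::nat \<times> nat. gauss v" by (rule product_sigma_finite_gauss [OF v])
  have tt: "0 \<le> tt 0" "mono tt" by (auto simp: tt_def mono_def divide_right_mono)
  have indep: "indep_vars (\<lambda>_. state_space d) inc {..<N}"
    using wiener tt unfolding standard_wiener_def inc_def by blast
  have inc_m: "inc k \<in> M \<rightarrow>\<^sub>M state_space d" if "k < N" for k
    using indep that unfolding indep_vars_def by auto
  have inc_law: "distr M (state_space d) (inc k) = (\<Pi>\<^sub>M i\<in>{..<d}. gauss v)" for k
  proof -
    have *: "0 \<le> tt k" "tt k < tt (Suc k)" "tt (Suc k) - tt k = v"
      using n by (auto simp: tt_def v_def field_simps)
    have "\<forall>u t. 0 \<le> u \<and> u < t \<longrightarrow> distr M (state_space d) (increment d Z u t) =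
        (\<Pi>\<^sub>M i\<in>{..<d}. gauss (t - u))"
      using wiener unfolding standard_wiener_def gauss_def by (elim conjE)
    then have "distr M (state_space d) (inc k) = (\<Pi>\<^sub>M i\<in>{..<d}. gauss (tt (Suc k) - tt k))"
      using *(1,2) unfolding inc_def by blast
    then show ?thesis by (simp only: *(3))
  qed
  have "distr M (PiM ({..<N} \<times> {..<d}) (\<lambda>_. borel)) (noise d n N Z)
       = PiM ({..<N} \<times> {..<d}) (\<lambda>_. gauss v)"
  proof (rule measure_eqI_PiM_finite [where I = "{..<N} \<times> {..<d}" and M = "\<lambda>_. borel"
        and A = "\<lambda>_. space (PiM ({..<N} \<times> {..<d}) (\<lambda>_. borel))"])
    show "sets (PiM ({..<N} \<times> {..<d}) (\<lambda>_. gauss v)) = sets (PiM ({..<N} \<times> {..<d}) (\<lambda>_. borel))"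
      by (intro sets_PiM_cong) auto
    interpret D: prob_space "distr M (PiM ({..<N} \<times> {..<d}) (\<lambda>_. borel)) (noise d n N Z)"
      by (rule prob_space_distr [OF measurable_noise [OF sp]])
    show "emeasure (distr M (PiM ({..<N} \<times> {..<d}) (\<lambda>_. borel)) (noise d n N Z))
       (space (PiM ({..<N} \<times> {..<d}) (\<lambda>_. borel))) \<noteq> \<infinity>"
      using D.emeasure_finite by simp
    show "range (\<lambda>_. space (PiM ({..<N} \<times> {..<d}) (\<lambda>_. borel)))
      \<subseteq> prod_algebra ({..<N} \<times> {..<d}) (\<lambda>_. borel :: real measure)"
      unfolding space_PiM by (auto intro!: prod_algebraI_finite)
  next
    fix A :: "nat \<times> nat \<Rightarrow> real set"
    assume A: "\<And>p. p \<in> {..<N} \<times> {..<d} \<Longrightarrow> A p \<in> sets borel"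
    define B where "B k = Pi\<^sub>E {..<d} (\<lambda>i. A (k, i))" for k
    have B: "B k \<in> sets (state_space d)" if "k < N" for k
      unfolding B_def state_space_def using that A by (intro sets_PiM_I_finite) auto
    have pre: "noise d n N Z -` (Pi\<^sub>E ({..<N} \<times> {..<d}) A) \<inter> space M = (\<Inter>k\<in>{..<N}. inc k -` B k \<inter> space M)"
      using N by (auto simp: noise_def inc_def increment_def B_def PiE_iff tt_def)
    have "emeasure (distr M (PiM ({..<N} \<times> {..<d}) (\<lambda>_. borel)) (noise d n N Z)) (Pi\<^sub>E ({..<N} \<times> {..<d}) A)
        = emeasure M (\<Inter>k\<in>{..<N}. inc k -` B k \<inter> space M)"
      using A by (subst emeasure_distr [OF measurable_noise [OF sp]])
        (auto simp: pre intro!: sets_PiM_I_finite)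
    also have "\<dots> = ennreal (\<Prod>k<N. prob (inc k -` B k \<inter> space M))"
      using indep_varsD [OF indep, of "{..<N}" B] N B by (simp add: emeasure_eq_measure lessThan_empty_iff)
    also have "\<dots> = (\<Prod>k<N. emeasure M (inc k -` B k \<inter> space M))"
      by (simp add: emeasure_eq_measure prod_ennreal)
    also have "\<dots> = (\<Prod>k<N. emeasure (distr M (state_space d) (inc k)) (B k))"
      by (intro prod.cong refl) (simp add: emeasure_distr inc_m B)
    also have "\<dots> = (\<Prod>k<N. \<Prod>i<d. emeasure (gauss v) (A (k, i)))"
      unfolding inc_law B_def using A by (intro prod.cong refl G.emeasure_PiM) auto
    also have "\<dots> = (\<Prod>p\<in>{..<N} \<times> {..<d}. emeasure (gauss v) (A p))"
      by (simp add: prod.cartesian_product)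
    also have "\<dots> = emeasure (PiM ({..<N} \<times> {..<d}) (\<lambda>_. gauss v)) (Pi\<^sub>E ({..<N} \<times> {..<d}) A)"
      using A by (intro GG.emeasure_PiM [symmetric]) auto
    finally show "emeasure (distr M (PiM ({..<N} \<times> {..<d}) (\<lambda>_. borel)) (noise d n N Z)) (Pi\<^sub>E ({..<N} \<times> {..<d}) A)
      = emeasure (PiM ({..<N} \<times> {..<d}) (\<lambda>_. gauss v)) (Pi\<^sub>E ({..<N} \<times> {..<d}) A)" .
  qed auto
  then show ?thesis by (simp add: v_def)
qed

section \<open>Pathwise convergence of the Euler scheme\<close>

text \<open>One-dimensional error analysis for \<open>dx = - (\<lambda> x + b) dt + dz\<close> with an approximate input \<open>b'\<close>.
Because the noise is additive, the increments of \<open>z\<close> cancel, and one step contributes only the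
oscillation \<open>\<omega>\<close> of \<open>x\<close> over a mesh interval and the error \<open>\<beta>\<close> of the input. The contraction factor
\<open>r\<close> turns the former into a single \<open>\<omega>\<close>, uniformly in the number of steps, and damps the neglected
initial value.\<close>

lemma euler_step_error:
  fixes x b z :: "real \<Rightarrow> real"
  assumes cont: "continuous_on {0..} x" "continuous_on {0..} b"
    and eq: "\<And>t. 0 \<le> t \<Longrightarrow> x t = x 0 - integral {0..t} (\<lambda>u. lam * x u + b u) + z t"
    and n: "0 < n" and lam: "0 < lam" "lam \<le> real n"
    and osc: "\<And>j u. j < k \<Longrightarrow> real j / real n \<le> u \<Longrightarrow> u \<le> real (Suc j) / real n \<Longrightarrow>
      \<bar>x u - x (real j / real n)\<bar> \<le> \<omega> \<and> \<bar>b u - b' j\<bar> \<le> \<beta> j"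
    and \<omega>: "0 \<le> \<omega>"
  defines "r \<equiv> 1 - lam / real n"
  shows "\<bar>x (real k / real n) - ar r (\<lambda>j. z (real (Suc j) / real n) - z (real j / real n) - b' j / real n) k\<bar>
    \<le> r ^ k * \<bar>x 0\<bar> + \<omega> + ar r \<beta> k / real n"
  using osc
proof (induction k)
  case 0
  then show ?case using \<omega> by simp
next
  case (Suc k)
  define s t where "s = real k / real n" and "t = real (Suc k) / real n"
  have st: "0 \<le> s" "s \<le> t" "t - s = 1 / real n"
    using n by (auto simp: s_def t_def field_simps)
  have r: "0 \<le> r" using lam n by (simp add: r_def field_simps)
  define y where "y = ar r (\<lambda>j. z (real (Suc j) / real n) - z (real j / real n) - b' j / real n)"
  define f where "f u = lam * x u + b u" for u
  have fc: "continuous_on {0..} f" unfolding f_def by (intro continuous_intros cont)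
  have fi: "f integrable_on {0..t}"
    by (intro integrable_continuous_interval continuous_on_subset [OF fc]) auto
  have "integral {0..s} f + integral {s..t} f = integral {0..t} f"
    using st fi by (intro Henstock_Kurzweil_Integration.integral_combine) auto
  then have xt: "x t = x s - integral {s..t} f + (z t - z s)"
    using eq [of s] eq [of t] st by (simp add: f_def [abs_def])
  define c where "c = lam * x s + b' k"
  have fcs: "continuous_on {s..t} f" using st by (intro continuous_on_subset [OF fc]) auto
  have "integral {s..t} (\<lambda>u. f u - c) = integral {s..t} f - c / real n"
    using st fcs by (subst integral_diff) (auto intro: integrable_continuous_interval)
  moreover have "norm (integral {s..t} (\<lambda>u. f u - c)) \<le> (lam * \<omega> + \<beta> k) * (t - s)"
  proof (rule integral_bound)
    show "continuous_on {s..t} (\<lambda>u. f u - c)" by (intro continuous_intros fcs)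
    fix u assume u: "u \<in> {s..t}"
    have "\<bar>x u - x s\<bar> \<le> \<omega> \<and> \<bar>b u - b' k\<bar> \<le> \<beta> k"
      using Suc.prems [of k u] u by (simp add: s_def t_def)
    moreover have "f u - c = lam * (x u - x s) + (b u - b' k)"
      by (simp add: f_def c_def algebra_simps)
    moreover have "\<bar>lam * (x u - x s)\<bar> = lam * \<bar>x u - x s\<bar>" using lam by (simp add: abs_mult)
    moreover have "lam * \<bar>x u - x s\<bar> \<le> lam * \<omega>" using calculation lam by (intro mult_left_mono) auto
    ultimately show "norm (f u - c) \<le> lam * \<omega> + \<beta> k"
      unfolding real_norm_def by linarith
  qed (use st in simp)
  ultimately have int: "\<bar>integral {s..t} f - c / real n\<bar> \<le> (lam * \<omega> + \<beta> k) / real n"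
    using st by simp
  have ySuc: "y (Suc k) = r * y k + (z t - z s - b' k / real n)"
    by (simp add: y_def s_def t_def)
  have "x t - y (Suc k) = r * (x s - y k) - (integral {s..t} f - c / real n)"
    unfolding xt ySuc c_def r_def by (simp add: algebra_simps add_divide_distrib)
  then have "\<bar>x t - y (Suc k)\<bar> \<le> r * \<bar>x s - y k\<bar> + (lam * \<omega> + \<beta> k) / real n"
    using int abs_triangle_ineq4 [of "r * (x s - y k)" "integral {s..t} f - c / real n"] r
    by (simp add: abs_mult)
  also have "\<dots> \<le> r * (r ^ k * \<bar>x 0\<bar> + \<omega> + ar r \<beta> k / real n) + (lam * \<omega> + \<beta> k) / real n"
  proof -
    have "\<bar>x s - y k\<bar> \<le> r ^ k * \<bar>x 0\<bar> + \<omega> + ar r \<beta> k / real n"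
      unfolding s_def y_def by (rule Suc.IH) (rule Suc.prems, auto)
    then show ?thesis using r by (intro add_right_mono mult_left_mono)
  qed
  also have "\<dots> = r ^ Suc k * \<bar>x 0\<bar> + \<omega> + ar r \<beta> (Suc k) / real n"
    unfolding r_def by (simp add: algebra_simps add_divide_distrib diff_divide_distrib)
  finally show ?case unfolding t_def y_def .
qed

text \<open>Half of the exponent is given up to absorb the factor \<open>k / n\<close> in the second bound, by \<open>x \<le> e\<^sup>x\<close> for
\<open>x = \<lambda> k / (2 n)\<close>. That factor is the effect of a decaying input on a state that decays at the same
rate.\<close>

lemma exp_decay_bounds:
  assumes n: "0 < n" and lam: "0 < lam" "2 * lam \<le> real n"
  shows "(1 - lam / real n) ^ k \<le> exp (- (lam * (real k / real n) / 2))"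
    and "real k * (1 - lam / real n) ^ (k - 1) / real n \<le> 4 / lam * exp (- (lam * (real k / real n) / 2))"
proof -
  define r y where "r = 1 - lam / real n" and "y = real k / real n"
  have r: "1 / 2 \<le> r" using n lam by (simp add: r_def field_simps)
  have y: "0 \<le> y" by (simp add: y_def)
  have "r ^ k \<le> exp (- (lam / real n)) ^ k"
  proof (rule power_mono)
    show "r \<le> exp (- (lam / real n))"
      using exp_ge_add_one_self [of "- (lam / real n)"] by (simp add: r_def)
    show "0 \<le> r" using r by simp
  qed
  also have "\<dots> = exp (- (lam * y))"
    by (simp add: exp_of_nat_mult [symmetric] y_def)
  finally have rk: "r ^ k \<le> exp (- (lam * y))" .
  also have "\<dots> \<le> exp (- (lam * y / 2))" using lam y by simp
  finally show "(1 - lam / real n) ^ k \<le> exp (- (lam * (real k / real n) / 2))"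
    by (simp add: r_def y_def)
  have "y * r ^ (k - 1) \<le> y * (2 * r ^ k)"
  proof (cases k)
    case (Suc k')
    have "1 * r ^ k' \<le> (2 * r) * r ^ k'" using r by (intro mult_right_mono) auto
    then show ?thesis using y Suc by (intro mult_left_mono) auto
  qed (simp add: y_def)
  also have "\<dots> \<le> y * (2 * exp (- (lam * y)))"
    using rk y by (intro mult_left_mono) auto
  also have "\<dots> = 4 / lam * ((lam * y / 2) * exp (- (lam * y)))"
    using lam by simp
  also have "\<dots> \<le> 4 / lam * (exp (lam * y / 2) * exp (- (lam * y)))"
  proof (intro mult_left_mono mult_right_mono)
    show "lam * y / 2 \<le> exp (lam * y / 2)" using exp_ge_add_one_self [of "lam * y / 2"] by linarith
  qed (use lam in auto)
  also have "\<dots> = 4 / lam * exp (- (lam * y / 2))"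
    by (simp add: exp_add [symmetric])
  finally show "real k * (1 - lam / real n) ^ (k - 1) / real n
      \<le> 4 / lam * exp (- (lam * (real k / real n) / 2))"
    by (simp add: r_def y_def)
qed

definition ou_drift :: "nat \<Rightarrow> real \<Rightarrow> real \<Rightarrow> real mat" where
  "ou_drift d lam \<delta> = mat d d (\<lambda>(i, j). if i = j then lam else if i = 0 \<and> j = 1 then \<delta> else 0)"

lemma ou_drift_sum:
  assumes "2 \<le> d" "i < d"
  shows "(\<Sum>j<d. ou_drift d lam \<delta> $$ (i, j) * y j) = lam * y i + (if i = 0 then \<delta> * y 1 else 0)"
proof -
  have "(\<Sum>j<d. ou_drift d lam \<delta> $$ (i, j) * y j)
      = (\<Sum>j<d. (if j = i then lam * y i else 0) + (if j = 1 then if i = 0 then \<delta> * y 1 else 0 else 0))"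
    using assms by (intro sum.cong) (auto simp: ou_drift_def)
  also have "\<dots> = lam * y i + (if i = 0 then \<delta> * y 1 else 0)"
    using assms by (simp add: sum.distrib)
  finally show ?thesis .
qed

text \<open>For the coordinates other than 0 the scalar estimate applies without input. Its conclusion for
coordinate 1 bounds the error of the input to coordinate 0, to which the scalar estimate is applied
again.\<close>

lemma euler_error:
  fixes X Z :: "real \<Rightarrow> 'w \<Rightarrow> nat \<Rightarrow> real"
  assumes d: "2 \<le> d" and i: "i < d"
    and cont: "\<And>i. i < d \<Longrightarrow> continuous_on {0..} (\<lambda>t. X t w i)"
    and eq: "\<And>t i. 0 \<le> t \<Longrightarrow> i < d \<Longrightarrow> X t w i = X 0 w i
      - integral {0..t} (\<lambda>u. \<Sum>j<d. ou_drift d lam \<delta> $$ (i, j) * X u w j) + Z t w i"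
    and n: "0 < n" and lam: "0 < lam" "2 * lam \<le> real n"
    and osc: "\<And>i u v. i < d \<Longrightarrow> 0 \<le> u \<Longrightarrow> u \<le> v \<Longrightarrow> v \<le> real k / real n \<Longrightarrow> v - u \<le> 1 / real n \<Longrightarrow>
      \<bar>X v w i - X u w i\<bar> \<le> \<omega>"
    and \<omega>: "0 \<le> \<omega>" and k: "k \<le> N"
  shows "\<bar>X (real k / real n) w i - euler (1 - lam / real n) (\<delta> / real n) (noise d n N Z w) k i\<bar>
    \<le> (1 + 4 * \<bar>\<delta>\<bar> / lam) * exp (- (lam * (real k / real n) / 2)) * (\<Sum>j<d. \<bar>X 0 w j\<bar>)
      + (1 + 2 * \<bar>\<delta>\<bar> / lam) * \<omega>"
proof -
  define r where "r = 1 - lam / real n"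
  define g where "g = noise d n N Z w"
  define S where "S = (\<Sum>j<d. \<bar>X 0 w j\<bar>)"
  define E where "E = exp (- (lam * (real k / real n) / 2))"
  have lamn: "lam \<le> real n" using lam by simp
  have r: "0 \<le> r" "r < 1" using lam n lamn by (auto simp: r_def field_simps)
  have S: "\<bar>X 0 w j\<bar> \<le> S" if "j < d" for j
    unfolding S_def using that by (intro member_le_sum) auto
  have S0: "0 \<le> S" unfolding S_def by (intro sum_nonneg) auto
  have E0: "0 \<le> E" by (simp add: E_def)
  have g: "g (j, i) = Z (real (Suc j) / real n) w i - Z (real j / real n) w i" if "j < k" "i < d" for i j
    using that k by (simp add: g_def noise_def)
  have eq': "X t w i = X 0 w i - integral {0..t} (\<lambda>u. lam * X u w i + (if i = 0 then \<delta> * X u w 1 else 0)) + Z t w i"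
    if "0 \<le> t" "i < d" for t i
    using eq [OF that] by (simp only: ou_drift_sum [OF d that(2)])
  have osc': "\<bar>X u w i - X (real j / real n) w i\<bar> \<le> \<omega>"
    if "i < d" "j < k" "real j / real n \<le> u" "u \<le> real (Suc j) / real n" for i j u
  proof (rule osc)
    have "real (Suc j) / real n \<le> real k / real n" using that by (intro divide_right_mono) auto
    with that show "u \<le> real k / real n" by linarith
    show "u - real j / real n \<le> 1 / real n" using that by (simp add: add_divide_distrib)
  qed (use that in auto)
  have aut: "\<bar>X (real l / real n) w i - ar r (\<lambda>j. g (j, i)) l\<bar> \<le> r ^ l * \<bar>X 0 w i\<bar> + \<omega>"
    if "i < d" "i \<noteq> 0" "l \<le> k" for i l
  proof -
    have "\<bar>X (real l / real n) w i -
        ar r (\<lambda>j. Z (real (Suc j) / real n) w i - Z (real j / real n) w i - 0 / real n) l\<bar>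
      \<le> r ^ l * \<bar>X 0 w i\<bar> + \<omega> + ar r (\<lambda>_. 0) l / real n"
      unfolding r_def
    proof (rule euler_step_error [where x = "\<lambda>t. X t w i" and z = "\<lambda>t. Z t w i" and b = "\<lambda>_. 0"
          and b' = "\<lambda>_. 0" and \<beta> = "\<lambda>_. 0", OF cont [OF that(1)] _ _ n lam(1) lamn _ \<omega>])
      show "X t w i = X 0 w i - integral {0..t} (\<lambda>u. lam * X u w i + 0) + Z t w i" if "0 \<le> t" for t
        using eq' [OF that \<open>i < d\<close>] \<open>i \<noteq> 0\<close> by simp
      fix j u assume "j < l" "real j / real n \<le> u" "u \<le> real (Suc j) / real n"
      with that show "\<bar>X u w i - X (real j / real n) w i\<bar> \<le> \<omega> \<and> \<bar>0 - 0 :: real\<bar> \<le> 0"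
        using osc' [of i j u] by simp
    qed simp
    moreover have "ar r (\<lambda>_. 0) l = 0" by (induction l) auto
    moreover have "ar r (\<lambda>j. g (j, i)) l
        = ar r (\<lambda>j. Z (real (Suc j) / real n) w i - Z (real j / real n) w i - 0 / real n) l"
      using that g by (intro ar_cong) auto
    ultimately show ?thesis by simp
  qed
  have rE: "r ^ k \<le> E" unfolding r_def E_def by (rule exp_decay_bounds [OF n lam])
  show ?thesis
  proof (cases "i = 0")
    case False
    have "\<bar>X (real k / real n) w i - euler r (\<delta> / real n) g k i\<bar> \<le> r ^ k * \<bar>X 0 w i\<bar> + \<omega>"
      using aut [OF i False, of k] False by (simp add: euler_def)
    also have "\<dots> \<le> 1 * E * S + 1 * \<omega>"
      using rE S [OF i] r E0 by (auto intro!: mult_mono)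
    also have "\<dots> \<le> (1 + 4 * \<bar>\<delta>\<bar> / lam) * E * S + (1 + 2 * \<bar>\<delta>\<bar> / lam) * \<omega>"
      using E0 S0 \<omega> lam by (intro add_mono mult_right_mono) auto
    finally show ?thesis by (simp add: r_def g_def S_def E_def)
  next
    case True
    define y where "y = ar r (\<lambda>l. g (l, 1))"
    define \<beta> where "\<beta> j = \<bar>\<delta>\<bar> * (2 * \<omega> * 1 + \<bar>X 0 w 1\<bar> * r ^ j)" for j
    have "\<bar>X (real k / real n) w 0 -
        ar r (\<lambda>j. Z (real (Suc j) / real n) w 0 - Z (real j / real n) w 0 - \<delta> * y j / real n) k\<bar>
      \<le> r ^ k * \<bar>X 0 w 0\<bar> + \<omega> + ar r \<beta> k / real n"
      unfolding r_def
    proof (rule euler_step_error [where x = "\<lambda>t. X t w 0" and z = "\<lambda>t. Z t w 0"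
          and b = "\<lambda>u. \<delta> * X u w 1" and b' = "\<lambda>j. \<delta> * y j" and \<beta> = \<beta>,
          OF _ _ _ n lam(1) lamn _ \<omega>])
      fix j u assume j: "j < k" and u: "real j / real n \<le> u" "u \<le> real (Suc j) / real n"
      have "\<bar>X u w 1 - y j\<bar> \<le> \<bar>X u w 1 - X (real j / real n) w 1\<bar> + \<bar>X (real j / real n) w 1 - y j\<bar>"
        by linarith
      also have "\<dots> \<le> \<omega> + (r ^ j * \<bar>X 0 w 1\<bar> + \<omega>)"
        unfolding y_def using d j u by (intro add_mono osc' aut) auto
      finally have "\<bar>\<delta>\<bar> * \<bar>X u w 1 - y j\<bar> \<le> \<bar>\<delta>\<bar> * (\<omega> + (r ^ j * \<bar>X 0 w 1\<bar> + \<omega>))"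
        by (intro mult_left_mono) auto
      then have "\<bar>\<delta> * X u w 1 - \<delta> * y j\<bar> \<le> \<beta> j"
        by (simp add: \<beta>_def abs_mult [symmetric] right_diff_distrib mult_ac add_ac)
      with osc' [of 0 j u] d j u show "\<bar>X u w 0 - X (real j / real n) w 0\<bar> \<le> \<omega>
        \<and> \<bar>\<delta> * X u w 1 - \<delta> * y j\<bar> \<le> \<beta> j" by simp
    next
      show "continuous_on {0..} (\<lambda>t. X t w 0)" using cont [of 0] d by simp
      show "continuous_on {0..} (\<lambda>t. \<delta> * X t w 1)" using cont [of 1] d by (intro continuous_intros) simp
      show "X t w 0 = X 0 w 0 - integral {0..t} (\<lambda>u. lam * X u w 0 + \<delta> * X u w 1) + Z t w 0"
        if "0 \<le> t" for t using eq' [of t 0] that d by simp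
    qed
    also have "ar r (\<lambda>j. Z (real (Suc j) / real n) w 0 - Z (real j / real n) w 0 - \<delta> * y j / real n) k
        = euler r (\<delta> / real n) g k i"
      unfolding euler_def y_def using g True d by (intro ar_cong) auto
    finally have "\<bar>X (real k / real n) w i - euler r (\<delta> / real n) g k i\<bar>
        \<le> r ^ k * \<bar>X 0 w 0\<bar> + \<omega> + ar r \<beta> k / real n" using True by simp
    also have "\<dots> \<le> E * S + \<omega> + (2 * \<bar>\<delta>\<bar> / lam * \<omega> + 4 * \<bar>\<delta>\<bar> / lam * E * S)"
    proof -
      have "ar r \<beta> k = \<bar>\<delta>\<bar> * (2 * \<omega> * ar r (\<lambda>_. 1) k + \<bar>X 0 w 1\<bar> * (real k * r ^ (k - 1)))"
        unfolding \<beta>_def by (simp only: ar_cmult ar_add ar_power)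
      then have "ar r \<beta> k / real n = \<bar>\<delta>\<bar> * (2 * \<omega> * (ar r (\<lambda>_. 1) k / real n)
          + \<bar>X 0 w 1\<bar> * (real k * r ^ (k - 1) / real n))"
        by (simp add: add_divide_distrib distrib_left)
      also have "\<dots> \<le> \<bar>\<delta>\<bar> * (2 * \<omega> * (1 / lam) + S * (4 / lam * E))"
      proof (intro mult_left_mono add_mono mult_mono)
        have "ar r (\<lambda>_. 1) k / real n \<le> 1 / (1 - r) / real n"
          using r by (intro divide_right_mono ar_one_le) auto
        also have "\<dots> = 1 / lam" using n lam by (simp add: r_def)
        finally show "ar r (\<lambda>_. 1) k / real n \<le> 1 / lam" .
        show "real k * r ^ (k - 1) / real n \<le> 4 / lam * E"
          unfolding r_def E_def by (rule exp_decay_bounds [OF n lam])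
        show "\<bar>X 0 w 1\<bar> \<le> S" using d by (intro S) simp
      qed (use \<omega> S0 r in auto)
      finally have "ar r \<beta> k / real n \<le> 2 * \<bar>\<delta>\<bar> / lam * \<omega> + 4 * \<bar>\<delta>\<bar> / lam * E * S"
        by (simp add: algebra_simps)
      moreover have "r ^ k * \<bar>X 0 w 0\<bar> \<le> E * S"
        using rE S [of 0] d r E0 by (intro mult_mono) auto
      ultimately show ?thesis by linarith
    qed
    also have "\<dots> = (1 + 4 * \<bar>\<delta>\<bar> / lam) * E * S + (1 + 2 * \<bar>\<delta>\<bar> / lam) * \<omega>"
      by (simp add: algebra_simps)
    finally show ?thesis by (simp add: r_def g_def S_def E_def)
  qed
qed

text \<open>The last grid point up to time \<open>h + t\<close>; the first \<open>h\<close> units of time are the prehistory.\<close>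

definition sample_index :: "nat \<Rightarrow> nat \<Rightarrow> real \<Rightarrow> nat" where
  "sample_index h n t = h * n + nat \<lfloor>t * real n\<rfloor>"

lemma sample_index:
  assumes n: "0 < n" and t: "0 \<le> t" "t \<le> real \<tau>"
  shows "h * n \<le> sample_index h n t" "sample_index h n t \<le> (h + \<tau>) * n"
    "real h \<le> real (sample_index h n t) / real n"
    "real (sample_index h n t) / real n \<le> t + real h"
    "t + real h - real (sample_index h n t) / real n \<le> 1 / real n"
proof -
  have fl: "real (nat \<lfloor>t * real n\<rfloor>) = real_of_int \<lfloor>t * real n\<rfloor>" using t by simp
  have s: "real (sample_index h n t) = real h * real n + real_of_int \<lfloor>t * real n\<rfloor>"
    by (simp add: sample_index_def fl)
  have f: "0 \<le> real_of_int \<lfloor>t * real n\<rfloor>" "real_of_int \<lfloor>t * real n\<rfloor> \<le> t * real n"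
    "t * real n \<le> real_of_int \<lfloor>t * real n\<rfloor> + 1"
    using t n by (auto intro: less_imp_le)
  show "h * n \<le> sample_index h n t" by (simp add: sample_index_def)
  have "t * real n \<le> real \<tau> * real n" using t by (intro mult_right_mono) auto
  moreover have "real ((h + \<tau>) * n) = real h * real n + real \<tau> * real n"
    by (simp add: distrib_right)
  ultimately have "real (sample_index h n t) \<le> real ((h + \<tau>) * n)"
    using f(2) s by linarith
  then show "sample_index h n t \<le> (h + \<tau>) * n" by linarith
  have sn: "real (sample_index h n t) / real n = real h + real_of_int \<lfloor>t * real n\<rfloor> / real n"
    using n by (simp add: s add_divide_distrib)
  show "real h \<le> real (sample_index h n t) / real n"
    "real (sample_index h n t) / real n \<le> t + real h"
    using n f by (auto simp: sn field_simps)
  have "(t * real n - real_of_int \<lfloor>t * real n\<rfloor>) / real n \<le> 1 / real n"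
  proof (rule divide_right_mono)
    show "t * real n - real_of_int \<lfloor>t * real n\<rfloor> \<le> 1" using f(3) by linarith
  qed simp
  then show "t + real h - real (sample_index h n t) / real n \<le> 1 / real n"
    using n by (simp add: sn diff_divide_distrib)
qed

text \<open>Uniform continuity on compact intervals makes the oscillations vanish with the mesh. What remains is
the effect of the initial value, which the scheme ignores; it is not removed by \<open>n \<rightarrow> \<infinity>\<close> and decays
with \<open>h\<close>.\<close>

lemma euler_converges:
  fixes X Z :: "real \<Rightarrow> 'w \<Rightarrow> nat \<Rightarrow> real"
  assumes d: "2 \<le> d" and lam: "0 < lam" and T: "T \<le> real \<tau>"
    and cont: "\<And>i. i < d \<Longrightarrow> continuous_on {0..} (\<lambda>t. X t w i)"
    and eq: "\<And>t i. 0 \<le> t \<Longrightarrow> i < d \<Longrightarrow> X t w i = X 0 w i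
      - integral {0..t} (\<lambda>u. \<Sum>j<d. ou_drift d lam \<delta> $$ (i, j) * X u w j) + Z t w i"
    and \<epsilon>: "0 < \<epsilon>"
  shows "\<forall>\<^sub>F n in sequentially. \<forall>t\<in>{0..T}. \<forall>i<d.
    \<bar>X (t + real h) w i - euler (1 - lam / real n) (\<delta> / real n)
        (noise d n ((h + \<tau>) * n) Z w) (sample_index h n t) i\<bar>
    \<le> (1 + 4 * \<bar>\<delta>\<bar> / lam) * exp (- (lam * real h / 2)) * (\<Sum>j<d. \<bar>X 0 w j\<bar>) + \<epsilon>"
proof -
  define C where "C = 1 + 2 * \<bar>\<delta>\<bar> / lam"
  have C: "1 \<le> C" using lam by (simp add: C_def)
  define \<omega> where "\<omega> = \<epsilon> / (2 * C)"
  have \<omega>: "0 < \<omega>" using \<epsilon> C by (simp add: \<omega>_def)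
  have "2 * C * \<omega> = \<epsilon>" using C by (simp add: \<omega>_def)
  moreover have "\<omega> \<le> C * \<omega>" using C \<omega> by simp
  ultimately have C\<omega>: "\<omega> + C * \<omega> \<le> \<epsilon>" by linarith
  define R where "R = real h + real \<tau>"
  have mod: "\<forall>\<^sub>F n in sequentially. \<forall>u v. 0 \<le> u \<longrightarrow> u \<le> v \<longrightarrow> v \<le> R \<longrightarrow> v - u \<le> 1 / real n \<longrightarrow>
      \<bar>X v w i - X u w i\<bar> \<le> \<omega>" if i: "i < d" for i
  proof -
    have "uniformly_continuous_on {0..R} (\<lambda>t. X t w i)"
      by (intro compact_uniformly_continuous continuous_on_subset [OF cont [OF i]]) auto
    then obtain \<eta> where \<eta>: "0 < \<eta>"
      and unif: "\<And>u v. u \<in> {0..R} \<Longrightarrow> v \<in> {0..R} \<Longrightarrow> dist v u < \<eta> \<Longrightarrow> dist (X v w i) (X u w i) < \<omega>"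
      using \<omega> unfolding uniformly_continuous_on_def by metis
    have "(\<lambda>n. 1 / real n) \<longlonglongrightarrow> 0" by (rule lim_1_over_n)
    then have "\<forall>\<^sub>F n in sequentially. 1 / real n < \<eta>" using \<eta> by (rule order_tendstoD)
    then show ?thesis
    proof eventually_elim
      case (elim n)
      show ?case
      proof (intro allI impI)
        fix u v assume "0 \<le> u" "u \<le> v" "v \<le> R" "v - u \<le> 1 / real n"
        with elim have "dist (X v w i) (X u w i) < \<omega>" by (intro unif) (auto simp: dist_real_def)
        then show "\<bar>X v w i - X u w i\<bar> \<le> \<omega>" by (simp add: dist_real_def)
      qed
    qed
  qed
  have "\<forall>\<^sub>F n in sequentially. \<forall>i\<in>{..<d}. \<forall>u v. 0 \<le> u \<longrightarrow> u \<le> v \<longrightarrow> v \<le> R \<longrightarrow> v - u \<le> 1 / real n \<longrightarrow>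
      \<bar>X v w i - X u w i\<bar> \<le> \<omega>"
    using mod by (intro eventually_ball_finite) auto
  moreover have "\<forall>\<^sub>F n in sequentially. 2 * lam \<le> real n"
    using filterlim_real_sequentially by (simp add: filterlim_at_top)
  moreover have "\<forall>\<^sub>F n in sequentially. 0 < (n::nat)" by (rule eventually_gt_at_top)
  ultimately show ?thesis
  proof eventually_elim
    case (elim n)
    note osc = elim(1) [rule_format] and ln = elim(2) and n = elim(3)
    show ?case
    proof (intro ballI allI impI)
      fix t i assume t: "t \<in> {0..T}" and i: "i < d"
      then have t': "0 \<le> t" "t \<le> real \<tau>" using T by auto
      define k where "k = sample_index h n t"
      note k = sample_index [OF n t', of h, folded k_def]
      have kR: "real k / real n \<le> R" using k(4) t' by (simp add: R_def)
      define Y where "Y = euler (1 - lam / real n) (\<delta> / real n) (noise d n ((h + \<tau>) * n) Z w) k i"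
      define S where "S = (\<Sum>j<d. \<bar>X 0 w j\<bar>)"
      have S0: "0 \<le> S" unfolding S_def by (intro sum_nonneg) auto
      have "\<bar>X (real k / real n) w i - Y\<bar>
        \<le> (1 + 4 * \<bar>\<delta>\<bar> / lam) * exp (- (lam * (real k / real n) / 2)) * S + C * \<omega>"
        unfolding Y_def S_def C_def
        by (rule euler_error [where X = X and w = w and Z = Z and lam = lam and \<delta> = \<delta> and \<omega> = \<omega>,
              OF d i cont eq n lam ln]) (use osc kR \<omega> k in auto)
      also have "\<dots> \<le> (1 + 4 * \<bar>\<delta>\<bar> / lam) * exp (- (lam * real h / 2)) * S + C * \<omega>"
      proof (intro add_right_mono mult_right_mono mult_left_mono)
        show "exp (- (lam * (real k / real n) / 2)) \<le> exp (- (lam * real h / 2))"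
          using mult_left_mono [OF k(3), of lam] lam by simp
      qed (use lam S0 in auto)
      finally have 1: "\<bar>X (real k / real n) w i - Y\<bar> \<le> \<dots>" .
      have "\<bar>X (t + real h) w i - X (real k / real n) w i\<bar> \<le> \<omega>"
        using k t' i by (intro osc) (auto simp: R_def)
      with 1 C\<omega> show "\<bar>X (t + real h) w i - Y\<bar> \<le> (1 + 4 * \<bar>\<delta>\<bar> / lam) * exp (- (lam * real h / 2)) * S + \<epsilon>"
        by linarith
    qed
  qed
qed

section \<open>Stationary laws as limits of Euler schemes\<close>

text \<open>The Lipschitz condition depends on the values at the times in \<open>J\<close> only, so it expresses both that
\<open>f\<close> is a function of finitely many coordinates and that it is Lipschitz in them.\<close>

definition lipschitz_test :: "nat \<Rightarrow> real \<Rightarrow> ((real \<Rightarrow> nat \<Rightarrow> real) \<Rightarrow> real) \<Rightarrow> bool" where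
  "lipschitz_test d T f \<longleftrightarrow>
     f \<in> borel_measurable (path_space d {0..T}) \<and> (\<forall>x. 0 \<le> f x \<and> f x \<le> 1) \<and>
     (\<exists>J L. finite J \<and> J \<subseteq> {0..T} \<and> 0 \<le> L \<and>
        (\<forall>x y. \<bar>f x - f y\<bar> \<le> L * (\<Sum>t\<in>J. \<Sum>i<d. \<bar>x t i - y t i\<bar>)))"

lemma measurable_path:
  assumes "\<And>t. t \<in> I \<Longrightarrow> X t \<in> M \<rightarrow>\<^sub>M state_space d"
  shows "path I X \<in> M \<rightarrow>\<^sub>M path_space d I"
  unfolding path_def [abs_def] path_space_def by (intro measurable_restrict assms)

lemma measurable_path_component:
  assumes "t \<in> I" "i < d"
  shows "(\<lambda>x. x t i) \<in> borel_measurable (path_space d I)"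
  unfolding path_space_def
  by (rule measurable_state_component [OF measurable_component_singleton [of t I "\<lambda>_. state_space d"]])
    (use assms in auto)

lemma stationary_shift_law:
  assumes st: "stationary_process d M X" and sp: "stochastic_process d M X" and h: "0 \<le> h"
  shows "distr M (path_space d {0..T}) (path {0..T} (\<lambda>t. X (t + h)))
       = distr M (path_space d {0..T}) (path {0..T} X)"
proof -
  define R where "R x = restrict x {0..T}" for x :: "real \<Rightarrow> nat \<Rightarrow> real"
  have R: "R \<in> path_space d {0..} \<rightarrow>\<^sub>M path_space d {0..T}"
    unfolding R_def [abs_def] path_space_def by (intro measurable_restrict_subset) auto
  have X: "X t \<in> M \<rightarrow>\<^sub>M state_space d" if "0 \<le> t" for t
    using sp that by (simp add: stochastic_process_def)
  have "distr M (path_space d {0..T}) (path {0..T} Y)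
      = distr (distr M (path_space d {0..}) (path {0..} Y)) (path_space d {0..T}) R"
    if "path {0..} Y \<in> M \<rightarrow>\<^sub>M path_space d {0..}" for Y
    by (subst distr_distr [OF R that]) (auto simp: comp_def R_def path_def restrict_def fun_eq_iff
        intro!: distr_cong)
  moreover have "path {0..} (\<lambda>t. X (t + h)) \<in> M \<rightarrow>\<^sub>M path_space d {0..}"
    "path {0..} X \<in> M \<rightarrow>\<^sub>M path_space d {0..}"
    using X h by (auto intro!: measurable_path)
  ultimately show ?thesis
    using st h by (simp add: stationary_process_def)
qed

text \<open>The order of the limits matters: for fixed \<open>h\<close> the difference between the process and the scheme
exceeds the measurable bound \<open>a h\<close> by an excess \<open>G h n\<close> that vanishes as \<open>n \<rightarrow> \<infinity>\<close>, and \<open>a h\<close>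
vanishes as \<open>h \<rightarrow> \<infinity>\<close>. As the test function takes values in \<open>[0, 1]\<close>, both may be capped at 1, and
dominated convergence applies whatever the tails of the initial value are.\<close>

lemma OU_law_approximation:
  assumes OU: "stationary_OU d (ou_drift d lam \<delta>) M X Z"
    and d: "2 \<le> d" and lam: "0 < lam" and T: "T \<le> real \<tau>" and \<tau>: "0 < \<tau>"
    and f: "lipschitz_test d T f" and \<epsilon>: "0 < \<epsilon>"
  shows "\<forall>\<^sub>F h in sequentially. \<forall>\<^sub>F n in sequentially.
    \<bar>(\<integral>x. f x \<partial>distr M (path_space d {0..T}) (path {0..T} X)) -
     (\<integral>g. f (euler_path d {0..T} (sample_index h n) (1 - lam / real n) (\<delta> / real n) g)
        \<partial>PiM ({..<(h + \<tau>) * n} \<times> {..<d}) (\<lambda>_. gauss (1 / real n)))\<bar> \<le> \<epsilon>"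
proof -
  from OU have wiener: "standard_wiener d M Z" and sp: "stochastic_process d M X"
    and cont: "continuous_paths d M X" and st: "stationary_process d M X"
    and eq: "AE w in M. \<forall>t\<ge>0. \<forall>i<d. X t w i = X 0 w i -
      integral {0..t} (\<lambda>u. \<Sum>j<d. ou_drift d lam \<delta> $$ (i, j) * X u w j) + Z t w i"
    by (auto simp: stationary_OU_def)
  have spZ: "stochastic_process d M Z" using wiener by (simp add: standard_wiener_def)
  interpret prob_space M using sp by (simp add: stochastic_process_def)
  from f obtain J L where fm: "f \<in> borel_measurable (path_space d {0..T})"
    and f01: "\<And>x. 0 \<le> f x" "\<And>x. f x \<le> 1" and J: "finite J" "J \<subseteq> {0..T}" and L: "0 \<le> L"
    and fL: "\<And>x y. \<bar>f x - f y\<bar> \<le> L * (\<Sum>t\<in>J. \<Sum>i<d. \<bar>x t i - y t i\<bar>)"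
    unfolding lipschitz_test_def by blast
  have Xm: "X t \<in> M \<rightarrow>\<^sub>M state_space d" if "0 \<le> t" for t
    using sp that by (simp add: stochastic_process_def)
  define XX where "XX h = path {0..T} (\<lambda>t. X (t + real h))" for h :: nat
  define YY where "YY h n w = euler_path d {0..T} (sample_index h n) (1 - lam / real n) (\<delta> / real n)
      (noise d n ((h + \<tau>) * n) Z w)" for h n w
  have index: "sample_index h n t \<le> (h + \<tau>) * n" if "t \<in> {0..T}" for h n t
    using that T by (cases "n = 0") (auto simp: sample_index_def [of h 0] intro!: sample_index)
  have em: "euler_path d {0..T} (sample_index h n) (1 - lam / real n) (\<delta> / real n)
      \<in> PiM ({..<(h + \<tau>) * n} \<times> {..<d}) (\<lambda>_. borel) \<rightarrow>\<^sub>M path_space d {0..T}" for h n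
    by (rule measurable_euler_path) (use index d in auto)
  have XXm: "XX h \<in> M \<rightarrow>\<^sub>M path_space d {0..T}" for h
    unfolding XX_def by (intro measurable_path Xm) auto
  have YYm: "YY h n \<in> M \<rightarrow>\<^sub>M path_space d {0..T}" for h n
    unfolding YY_def by (intro measurable_compose [OF measurable_noise [OF spZ] em])
  have fX: "(\<integral>x. f x \<partial>distr M (path_space d {0..T}) (path {0..T} X)) = (\<integral>w. f (XX h w) \<partial>M)" for h
    unfolding stationary_shift_law [OF st sp, of "real h", symmetric, simplified] XX_def [symmetric]
    by (rule integral_distr [OF XXm fm])
  have fY: "(\<integral>g. f (euler_path d {0..T} (sample_index h n) (1 - lam / real n) (\<delta> / real n) g)
        \<partial>PiM ({..<(h + \<tau>) * n} \<times> {..<d}) (\<lambda>_. gauss (1 / real n))) = (\<integral>w. f (YY h n w) \<partial>M)"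
    if n: "0 < n" for h n
  proof -
    have N: "0 < (h + \<tau>) * n" using n \<tau> by simp
    show ?thesis
      unfolding distr_noise [OF wiener n N, symmetric] YY_def
      by (intro integral_distr [OF measurable_noise [OF spZ] measurable_compose [OF em fm]])
  qed
  define D where "D h n w = (\<Sum>t\<in>J. \<Sum>i<d. \<bar>XX h w t i - YY h n w t i\<bar>)" for h n w
  define C where "C = 1 + 4 * \<bar>\<delta>\<bar> / lam"
  define S where "S w = (\<Sum>j<d. \<bar>X 0 w j\<bar>)" for w
  define K where "K = L * (real (card J) * real d)"
  have C: "0 \<le> C" using lam by (simp add: C_def)
  have K: "0 \<le> K" using L by (simp add: K_def)
  define a where "a h w = K * (C * exp (- (lam * real h / 2)) * S w)" for h w
  define G where "G h n w = min 1 (max 0 (L * D h n w - a h w))" for h n w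
  have Sm [measurable]: "S \<in> borel_measurable M"
    unfolding S_def using Xm [of 0]
    by (intro borel_measurable_sum borel_measurable_abs measurable_state_component) auto
  have am [measurable]: "a h \<in> borel_measurable M" for h unfolding a_def by measurable
  have Dm [measurable]: "D h n \<in> borel_measurable M" for h n
    unfolding D_def using J
    by (intro borel_measurable_sum borel_measurable_abs borel_measurable_diff
        measurable_compose [OF XXm measurable_path_component]
        measurable_compose [OF YYm measurable_path_component]) auto
  have Gm [measurable]: "G h n \<in> borel_measurable M" for h n unfolding G_def by measurable
  have a0: "0 \<le> a h w" for h w
    unfolding a_def S_def using K C by (intro mult_nonneg_nonneg sum_nonneg) auto

  have lim_a: "(\<lambda>h. \<integral>w. min 1 (a h w) \<partial>M) \<longlonglongrightarrow> (\<integral>w. 0 \<partial>M)"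
  proof (rule integral_dominated_convergence [where w = "\<lambda>_. 1"])
    show "AE w in M. (\<lambda>h. min 1 (a h w)) \<longlonglongrightarrow> 0"
    proof (rule AE_I2)
      fix w
      have "filterlim (\<lambda>h. lam / 2 * real h) at_top sequentially"
        using lam by (intro filterlim_tendsto_pos_mult_at_top [OF tendsto_const] filterlim_real_sequentially) auto
      then have "(\<lambda>h. exp (- (lam / 2 * real h))) \<longlonglongrightarrow> 0"
        by (intro filterlim_compose [OF exp_at_bot]) (simp add: filterlim_uminus_at_top)
      then have "(\<lambda>h. min 1 (K * C * S w * exp (- (lam / 2 * real h)))) \<longlonglongrightarrow> min 1 (K * C * S w * 0)"
        by (intro tendsto_intros)
      then show "(\<lambda>h. min 1 (a h w)) \<longlonglongrightarrow> 0"
        by (simp add: a_def mult_ac)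
    qed
    show "AE w in M. norm (min 1 (a h w)) \<le> 1" for h
      using a0 by (intro AE_I2) (auto simp: abs_le_iff intro: order_trans [of _ 0])
  qed auto

  have lim_G: "(\<lambda>n. \<integral>w. G h n w \<partial>M) \<longlonglongrightarrow> (\<integral>w. 0 \<partial>M)" for h
  proof (rule integral_dominated_convergence [where w = "\<lambda>_. 1"])
    show "AE w in M. (\<lambda>n. G h n w) \<longlonglongrightarrow> 0"
      using eq cont [unfolded continuous_paths_def]
    proof eventually_elim
      case (elim w)
      show ?case
      proof (rule tendstoI)
        fix e :: real assume e: "0 < e"
        define e' where "e' = e / 2 / (K + 1)"
        have e': "0 < e'" using e K by (simp add: e'_def)
        have "K * e' \<le> (K + 1) * e'" using e' by simp
        also have "\<dots> = e / 2"
        proof -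
          have "K + 1 \<noteq> 0" using K by linarith
          then show ?thesis unfolding e'_def by (metis nonzero_eq_divide_eq mult.commute)
        qed
        also have "\<dots> < e" using e by simp
        finally have Ke: "K * e' < e" .
        have "\<forall>\<^sub>F n in sequentially. \<forall>t\<in>{0..T}. \<forall>i<d.
          \<bar>X (t + real h) w i - euler (1 - lam / real n) (\<delta> / real n)
            (noise d n ((h + \<tau>) * n) Z w) (sample_index h n t) i\<bar>
          \<le> C * exp (- (lam * real h / 2)) * S w + e'"
          unfolding C_def S_def by (rule euler_converges [where X = X and w = w and Z = Z and \<delta> = \<delta>, OF d lam T elim(2) [rule_format] elim(1) [rule_format] e'])
        then show "\<forall>\<^sub>F n in sequentially. dist (G h n w) 0 < e"
        proof eventually_elim
          case (elim n)
          have "D h n w \<le> (\<Sum>t\<in>J. \<Sum>i<d. C * exp (- (lam * real h / 2)) * S w + e')"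
            unfolding D_def
          proof (intro sum_mono)
            fix t i assume "t \<in> J" "i \<in> {..<d}"
            with J elim show "\<bar>XX h w t i - YY h n w t i\<bar> \<le> C * exp (- (lam * real h / 2)) * S w + e'"
              by (auto simp: XX_def YY_def path_def euler_path_def)
          qed
          then have "L * D h n w \<le> L * (\<Sum>t\<in>J. \<Sum>i<d. C * exp (- (lam * real h / 2)) * S w + e')"
            using L by (intro mult_left_mono)
          also have "\<dots> = a h w + K * e'"
            by (simp add: a_def K_def algebra_simps)
          finally show ?case using Ke e by (auto simp: G_def)
        qed
      qed
    qed
    show "AE w in M. norm (G h n w) \<le> 1" for n by (intro AE_I2) (auto simp: G_def)
  qed auto

  have diff: "\<bar>f (XX h w) - f (YY h n w)\<bar> \<le> min 1 (a h w) + G h n w" for h n w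
  proof -
    have "\<bar>f (XX h w) - f (YY h n w)\<bar> \<le> L * D h n w" unfolding D_def by (rule fL)
    moreover have "\<bar>f (XX h w) - f (YY h n w)\<bar> \<le> 1"
      using f01 [of "XX h w"] f01 [of "YY h n w"] by auto
    ultimately show ?thesis using a0 [of h w] unfolding G_def by linarith
  qed
  have int: "integrable M (\<lambda>w. f (XX h w))" "integrable M (\<lambda>w. f (YY h n w))"
    "integrable M (\<lambda>w. min 1 (a h w))" "integrable M (\<lambda>w. G h n w)" for h n
    using f01 a0 measurable_compose [OF XXm fm] measurable_compose [OF YYm fm]
    by (auto intro!: integrable_const_bound [where B = 1] AE_I2 simp: G_def abs_le_iff
        intro: order_trans [of _ 0])
  have bound: "\<bar>(\<integral>w. f (XX h w) \<partial>M) - (\<integral>w. f (YY h n w) \<partial>M)\<bar>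
      \<le> (\<integral>w. min 1 (a h w) \<partial>M) + (\<integral>w. G h n w \<partial>M)" for h n
  proof -
    have "\<bar>(\<integral>w. f (XX h w) \<partial>M) - (\<integral>w. f (YY h n w) \<partial>M)\<bar>
        = \<bar>\<integral>w. f (XX h w) - f (YY h n w) \<partial>M\<bar>"
      using int by simp
    also have "\<dots> \<le> (\<integral>w. \<bar>f (XX h w) - f (YY h n w)\<bar> \<partial>M)" by (rule integral_abs_bound)
    also have "\<dots> \<le> (\<integral>w. min 1 (a h w) + G h n w \<partial>M)"
      using int by (intro integral_mono diff) auto
    finally show ?thesis using int by simp
  qed
  have "\<forall>\<^sub>F h in sequentially. (\<integral>w. min 1 (a h w) \<partial>M) < \<epsilon> / 2"
    using lim_a \<epsilon> by (intro order_tendstoD(2) [where y = "0 :: real"]) auto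
  then show ?thesis
  proof eventually_elim
    case (elim h)
    have "\<forall>\<^sub>F n in sequentially. (\<integral>w. G h n w \<partial>M) < \<epsilon> / 2"
      using lim_G [of h] \<epsilon> by (intro order_tendstoD(2) [where y = "0 :: real"]) auto
    moreover have "\<forall>\<^sub>F n in sequentially. 0 < (n::nat)" by (rule eventually_gt_at_top)
    ultimately show ?case
    proof eventually_elim
      case n: (elim n)
      show ?case
        using bound [of h n] elim n(1) unfolding fX [of h] fY [OF n(2)] by linarith
    qed
  qed
qed

section \<open>Events are approximated by Lipschitz functions\<close>

lemma lipschitz_testD:
  assumes "lipschitz_test d T f"
  shows "f \<in> borel_measurable (path_space d {0..T})" "0 \<le> f x" "f x \<le> 1"
  using assms by (auto simp: lipschitz_test_def)

lemma lipschitz_test_compl: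
  assumes "lipschitz_test d T f"
  shows "lipschitz_test d T (\<lambda>x. 1 - f x)"
  using assms unfolding lipschitz_test_def
  by (auto simp: abs_minus_commute)

lemma lipschitz_test_max:
  assumes f: "lipschitz_test d T f" and g: "lipschitz_test d T g"
  shows "lipschitz_test d T (\<lambda>x. max (f x) (g x))"
proof -
  from f obtain J L where J: "finite J" "J \<subseteq> {0..T}" and L: "0 \<le> L"
    and fL: "\<And>x y. \<bar>f x - f y\<bar> \<le> L * (\<Sum>t\<in>J. \<Sum>i<d. \<bar>x t i - y t i\<bar>)"
    unfolding lipschitz_test_def by blast
  from g obtain J' L' where J': "finite J'" "J' \<subseteq> {0..T}" and L': "0 \<le> L'"
    and gL: "\<And>x y. \<bar>g x - g y\<bar> \<le> L' * (\<Sum>t\<in>J'. \<Sum>i<d. \<bar>x t i - y t i\<bar>)"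
    unfolding lipschitz_test_def by blast
  have "\<bar>max (f x) (g x) - max (f y) (g y)\<bar> \<le> (L + L') * (\<Sum>t\<in>J \<union> J'. \<Sum>i<d. \<bar>x t i - y t i\<bar>)"
    for x y
  proof -
    define s where "s I = (\<Sum>t\<in>I. \<Sum>i<d. \<bar>x t i - y t i\<bar>)" for I
    have s: "s J \<le> s (J \<union> J')" "s J' \<le> s (J \<union> J')"
      unfolding s_def using J J' by (auto intro!: sum_mono2 sum_nonneg)
    have "\<bar>f x - f y\<bar> \<le> L * s (J \<union> J')"
      using fL [of x y] mult_left_mono [OF s(1) L] by (simp add: s_def)
    moreover have "\<bar>g x - g y\<bar> \<le> L' * s (J \<union> J')"
      using gL [of x y] mult_left_mono [OF s(2) L'] by (simp add: s_def)
    moreover have "\<bar>max (f x) (g x) - max (f y) (g y)\<bar> \<le> \<bar>f x - f y\<bar> + \<bar>g x - g y\<bar>"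
      by linarith
    ultimately show ?thesis by (simp add: s_def distrib_right)
  qed
  moreover have "(\<lambda>x. max (f x) (g x)) \<in> borel_measurable (path_space d {0..T})"
    using lipschitz_testD(1) [OF f] lipschitz_testD(1) [OF g] by measurable
  moreover have "0 \<le> max (f x) (g x) \<and> max (f x) (g x) \<le> 1" for x
    using lipschitz_testD(2,3) [OF f, of x] lipschitz_testD(2,3) [OF g, of x] by auto
  moreover have "finite (J \<union> J')" "J \<union> J' \<subseteq> {0..T}" "0 \<le> L + L'" using J J' L L' by auto
  ultimately show ?thesis unfolding lipschitz_test_def by blast
qed

lemma lipschitz_test_ramp:
  assumes t: "t \<in> {0..T}" and i: "i < d" and k: "0 \<le> k"
  shows "lipschitz_test d T (\<lambda>x. min 1 (max 0 (1 - k * (x t i - a))))"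
proof -
  have "(\<lambda>x. min 1 (max 0 (1 - k * (x t i - a)))) \<in> borel_measurable (path_space d {0..T})"
    using measurable_path_component [OF t i] by measurable
  moreover have "\<bar>min 1 (max 0 (1 - k * (x t i - a))) - min 1 (max 0 (1 - k * (y t i - a)))\<bar>
      \<le> k * (\<Sum>s\<in>{t}. \<Sum>j<d. \<bar>x s j - y s j\<bar>)" for x y
  proof -
    have "\<bar>x t i - y t i\<bar> \<le> (\<Sum>j<d. \<bar>x t j - y t j\<bar>)"
      by (rule member_le_sum [where f = "\<lambda>j. \<bar>x t j - y t j\<bar>"]) (use i in auto)
    then have "k * \<bar>x t i - y t i\<bar> \<le> k * (\<Sum>s\<in>{t}. \<Sum>j<d. \<bar>x s j - y s j\<bar>)"
      using k by (intro mult_left_mono) auto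
    moreover have "k * \<bar>x t i - y t i\<bar> = \<bar>(1 - k * (x t i - a)) - (1 - k * (y t i - a))\<bar>"
    proof -
      have "(1 - k * (x t i - a)) - (1 - k * (y t i - a)) = - (k * (x t i - y t i))"
        by (simp add: algebra_simps)
      then show ?thesis using k by (simp add: abs_mult)
    qed
    ultimately show ?thesis by linarith
  qed
  moreover have "finite {t}" "{t} \<subseteq> {0..T}" using t by auto
  ultimately show ?thesis using k unfolding lipschitz_test_def
    by (intro conjI allI exI [of _ "{t}"] exI [of _ k]) auto
qed

text \<open>The events with this property form a sigma-algebra: complements and finite unions correspond to
\<open>1 - f\<close> and \<open>max f g\<close>, and countable unions are limits of finite ones. It contains the half spaces
\<open>x t i \<le> a\<close>, which are limits of ramps. All coordinates are therefore measurable with respect to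
it, and it contains the product sigma-algebra. The measures in \<open>R\<close> are treated together because one
\<open>f\<close> has to serve all of them.\<close>

lemma lipschitz_test_approximation:
  assumes fin: "finite R"
    and R: "\<And>P. P \<in> R \<Longrightarrow> prob_space P \<and> sets P = sets (path_space d {0..T})"
    and E: "E \<in> sets (path_space d {0..T})" and \<epsilon>: "0 < \<epsilon>"
  shows "\<exists>f. lipschitz_test d T f \<and> (\<forall>P\<in>R. (\<integral>x. \<bar>indicator E x - f x\<bar> \<partial>P) < \<epsilon>)"
proof -
  define \<Omega> where "\<Omega> = space (path_space d {0..T})"
  define CC where "CC = {E \<in> sets (path_space d {0..T}). \<forall>\<epsilon>>0. \<exists>f. lipschitz_test d T f \<and>
    (\<forall>P\<in>R. (\<integral>x. \<bar>indicator E x - f x\<bar> \<partial>P) < \<epsilon>)}"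
  have sp: "space P = \<Omega>" if "P \<in> R" for P
    using R [OF that] sets_eq_imp_space_eq unfolding \<Omega>_def by blast
  have int: "integrable P (\<lambda>x. \<bar>indicator A x - f x\<bar>)"
    if "P \<in> R" "A \<in> sets (path_space d {0..T})" "lipschitz_test d T f" for P A f
  proof -
    interpret prob_space P using R that by auto
    have [measurable]: "A \<in> sets P" "f \<in> borel_measurable P"
      using R [OF that(1)] that(2) lipschitz_testD(1) [OF that(3)] measurable_cong_sets by blast+
    have "\<bar>indicator A x - f x\<bar> \<le> 1" for x
      using lipschitz_testD(2,3) [OF that(3), of x] by (cases "x \<in> A") auto
    then show ?thesis by (intro integrable_const_bound [where B = 1] AE_I2) auto
  qed
  have CC_sets: "A \<in> sets (path_space d {0..T})" if "A \<in> CC" for A using that by (simp add: CC_def)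
  have CC_ex: "\<exists>f. lipschitz_test d T f \<and> (\<forall>P\<in>R. (\<integral>x. \<bar>indicator A x - f x\<bar> \<partial>P) < e)"
    if "A \<in> CC" "0 < e" for A and e :: real using that by (simp add: CC_def)

  have un: "A \<union> B \<in> CC" if AB: "A \<in> CC" "B \<in> CC" for A B
  proof -
    have "\<exists>f. lipschitz_test d T f \<and> (\<forall>P\<in>R. (\<integral>x. \<bar>indicator (A \<union> B) x - f x\<bar> \<partial>P) < e)"
      if e: "0 < e" for e :: real
    proof -
      obtain f where f: "lipschitz_test d T f" "\<And>P. P \<in> R \<Longrightarrow> (\<integral>x. \<bar>indicator A x - f x\<bar> \<partial>P) < e / 2"
        using CC_ex [OF AB(1), of "e / 2"] e by auto
      obtain g where g: "lipschitz_test d T g" "\<And>P. P \<in> R \<Longrightarrow> (\<integral>x. \<bar>indicator B x - g x\<bar> \<partial>P) < e / 2"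
        using CC_ex [OF AB(2), of "e / 2"] e by auto
      have "(\<integral>x. \<bar>indicator (A \<union> B) x - max (f x) (g x)\<bar> \<partial>P) < e" if P: "P \<in> R" for P
      proof -
        have "(\<integral>x. \<bar>indicator (A \<union> B) x - max (f x) (g x)\<bar> \<partial>P)
            \<le> (\<integral>x. \<bar>indicator A x - f x\<bar> + \<bar>indicator B x - g x\<bar> \<partial>P)"
        proof (rule integral_mono)
          show "integrable P (\<lambda>x. \<bar>indicator (A \<union> B) x - max (f x) (g x)\<bar>)"
            using P AB f g by (intro int lipschitz_test_max sets.Un CC_sets)
          show "integrable P (\<lambda>x. \<bar>indicator A x - f x\<bar> + \<bar>indicator B x - g x\<bar>)"
            using P AB f g by (intro Bochner_Integration.integrable_add int CC_sets)
          show "\<bar>indicator (A \<union> B) x - max (f x) (g x)\<bar> \<le> \<bar>indicator A x - f x\<bar> + \<bar>indicator B x - g x\<bar>"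
            for x
            using lipschitz_testD(2,3) [OF f(1), of x] lipschitz_testD(2,3) [OF g(1), of x]
            by (auto simp: indicator_def)
        qed
        also have "\<dots> = (\<integral>x. \<bar>indicator A x - f x\<bar> \<partial>P) + (\<integral>x. \<bar>indicator B x - g x\<bar> \<partial>P)"
          using P AB f g by (intro Bochner_Integration.integral_add int CC_sets)
        finally show ?thesis using f(2) [OF P] g(2) [OF P] by linarith
      qed
      with lipschitz_test_max [OF f(1) g(1)] show ?thesis by blast
    qed
    then show ?thesis using AB by (auto simp: CC_def)
  qed
  have zero: "lipschitz_test d T (\<lambda>_. 0)"
    unfolding lipschitz_test_def
    by (rule conjI, simp, rule conjI, simp, rule exI [of _ "{}"], rule exI [of _ 0], simp)
  have empty: "{} \<in> CC" using zero by (auto simp: CC_def intro!: exI [of _ "\<lambda>_. 0"])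
  have compl: "\<Omega> - A \<in> CC" if A: "A \<in> CC" for A
  proof -
    have "\<exists>f. lipschitz_test d T f \<and> (\<forall>P\<in>R. (\<integral>x. \<bar>indicator (\<Omega> - A) x - f x\<bar> \<partial>P) < e)"
      if e: "0 < e" for e :: real
    proof -
      obtain f where f: "lipschitz_test d T f" "\<And>P. P \<in> R \<Longrightarrow> (\<integral>x. \<bar>indicator A x - f x\<bar> \<partial>P) < e"
        using CC_ex [OF A e] by auto
      have "(\<integral>x. \<bar>indicator (\<Omega> - A) x - (1 - f x)\<bar> \<partial>P) = (\<integral>x. \<bar>indicator A x - f x\<bar> \<partial>P)"
        if P: "P \<in> R" for P
        using sp [OF P] by (intro Bochner_Integration.integral_cong) (auto simp: indicator_def)
      with f lipschitz_test_compl [OF f(1)] show ?thesis by (intro exI [of _ "\<lambda>x. 1 - f x"]) auto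
    qed
    then show ?thesis using A by (auto simp: CC_def \<Omega>_def)
  qed
  have UN: "(\<Union>i. A i) \<in> CC" if A: "range A \<subseteq> CC" for A :: "nat \<Rightarrow> _"
  proof -
    define B where "B n = (\<Union>i<n. A i)" for n
    have Am: "A i \<in> sets (path_space d {0..T})" for i using A by (intro CC_sets) auto
    have B: "B n \<in> CC" for n
    proof (induction n)
      case (Suc n)
      have "B (Suc n) = A n \<union> B n" by (auto simp: B_def less_Suc_eq)
      with un [of "A n" "B n"] Suc A show ?case by auto
    qed (simp add: B_def empty)
    have Bm: "B n \<in> sets (path_space d {0..T})" for n using B by (intro CC_sets)
    have UB: "(\<Union>n. B n) = (\<Union>i. A i)" by (auto simp: B_def)
    have "\<exists>f. lipschitz_test d T f \<and> (\<forall>P\<in>R. (\<integral>x. \<bar>indicator (\<Union>i. A i) x - f x\<bar> \<partial>P) < e)"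
      if e: "0 < e" for e :: real
    proof -
      have "\<forall>\<^sub>F n in sequentially. measure P (\<Union>i. A i) - measure P (B n) < e / 2" if P: "P \<in> R" for P
      proof -
        interpret prob_space P using R P by auto
        have "incseq B" by (intro incseq_SucI) (auto simp: B_def less_Suc_eq)
        then have "(\<lambda>n. measure P (B n)) \<longlonglongrightarrow> measure P (\<Union>n. B n)"
          using Bm R [OF P] by (intro finite_Lim_measure_incseq) auto
        then have "\<forall>\<^sub>F n in sequentially. measure P (\<Union>i. A i) - e / 2 < measure P (B n)"
          using e by (intro order_tendstoD(1)) (auto simp: UB)
        then show ?thesis by eventually_elim auto
      qed
      then have "\<forall>\<^sub>F n in sequentially. \<forall>P\<in>R. measure P (\<Union>i. A i) - measure P (B n) < e / 2"
        using fin by (intro eventually_ball_finite) auto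
      then obtain n where n: "\<And>P. P \<in> R \<Longrightarrow> measure P (\<Union>i. A i) - measure P (B n) < e / 2"
        unfolding eventually_sequentially by blast
      obtain f where f: "lipschitz_test d T f" "\<And>P. P \<in> R \<Longrightarrow> (\<integral>x. \<bar>indicator (B n) x - f x\<bar> \<partial>P) < e / 2"
        using CC_ex [OF B [of n], of "e / 2"] e by auto
      have "(\<integral>x. \<bar>indicator (\<Union>i. A i) x - f x\<bar> \<partial>P) < e" if P: "P \<in> R" for P
      proof -
        interpret prob_space P using R P by auto
        have Pm: "(\<Union>i. A i) \<in> events" "B n \<in> events" using R [OF P] Am Bm by auto
        have sub: "B n \<subseteq> (\<Union>i. A i)" by (auto simp: B_def)
        have "(\<integral>x. \<bar>indicator (\<Union>i. A i) x - f x\<bar> \<partial>P)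
            \<le> (\<integral>x. indicator ((\<Union>i. A i) - B n) x + \<bar>indicator (B n) x - f x\<bar> \<partial>P)"
        proof (rule integral_mono)
          show "integrable P (\<lambda>x. \<bar>indicator (\<Union>i. A i) x - f x\<bar>)"
            using P f Am by (intro int) auto
          show "integrable P (\<lambda>x. indicator ((\<Union>i. A i) - B n) x + \<bar>indicator (B n) x - f x\<bar>)"
            using P f Bm Pm by (intro Bochner_Integration.integrable_add int)
              (auto simp: less_top [symmetric])
          show "\<bar>indicator (\<Union>i. A i) x - f x\<bar> \<le> indicator ((\<Union>i. A i) - B n) x + \<bar>indicator (B n) x - f x\<bar>"
            for x
            using lipschitz_testD(2,3) [OF f(1), of x] sub by (auto simp: indicator_def)
        qed
        also have "\<dots> = prob ((\<Union>i. A i) - B n) + (\<integral>x. \<bar>indicator (B n) x - f x\<bar> \<partial>P)"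
          using P f Bm Pm by (subst Bochner_Integration.integral_add)
            (auto intro!: int simp: less_top [symmetric])
        also have "prob ((\<Union>i. A i) - B n) = prob (\<Union>i. A i) - prob (B n)"
          using Pm sub by (intro finite_measure_Diff)
        finally show ?thesis using n [OF P] f(2) [OF P] by linarith
      qed
      with f show ?thesis by blast
    qed
    then show ?thesis using Am by (auto simp: CC_def)
  qed
  have half: "{x \<in> \<Omega>. x t i \<le> a} \<in> CC" if t: "t \<in> {0..T}" and i: "i < d" for t i and a :: real
  proof -
    have H: "{x \<in> \<Omega>. x t i \<le> a} \<in> sets (path_space d {0..T})"
      unfolding \<Omega>_def using measurable_path_component [OF t i] by measurable
    define f where "f k x = min 1 (max 0 (1 - real k * (x t i - a)))" for k :: nat and x :: "real \<Rightarrow> nat \<Rightarrow> real"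
    have f: "lipschitz_test d T (f k)" for k
      unfolding f_def by (rule lipschitz_test_ramp [OF t i]) simp
    have lim: "(\<lambda>k. \<integral>x. \<bar>indicator {x \<in> \<Omega>. x t i \<le> a} x - f k x\<bar> \<partial>P) \<longlonglongrightarrow> (\<integral>x. 0 \<partial>P)" if P: "P \<in> R" for P
    proof -
      interpret prob_space P using R P by auto
      show ?thesis
      proof (rule integral_dominated_convergence [where w = "\<lambda>_. 1"])
        show "AE x in P. (\<lambda>k. \<bar>indicator {x \<in> \<Omega>. x t i \<le> a} x - f k x\<bar>) \<longlonglongrightarrow> 0"
        proof (rule AE_I2)
          fix x assume x: "x \<in> space P"
          show "(\<lambda>k. \<bar>indicator {x \<in> \<Omega>. x t i \<le> a} x - f k x\<bar>) \<longlonglongrightarrow> 0"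
          proof (cases "x t i \<le> a")
            case True
            then have "real k * (x t i - a) \<le> 0" for k :: nat
              by (intro mult_nonneg_nonpos) auto
            then have "f k x = 1" for k
              unfolding f_def by (smt (verit))
            then show ?thesis using True x sp [OF P] by simp
          next
            case False
            obtain k0 :: nat where k0: "1 / (x t i - a) \<le> real k0" using real_arch_simple by blast
            have "f k x = 0" if "k \<ge> k0" for k
            proof -
              have "1 / (x t i - a) \<le> real k" using k0 that by linarith
              then have "1 \<le> real k * (x t i - a)" using False by (simp add: field_simps)
              then show ?thesis by (simp add: f_def)
            qed
            then have "\<forall>\<^sub>F k in sequentially. \<bar>indicator {x \<in> \<Omega>. x t i \<le> a} x - f k x\<bar> = 0"
              using False unfolding eventually_sequentially by (intro exI [of _ k0]) auto
            then show ?thesis by (rule tendsto_eventually)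
          qed
        qed
        show "AE x in P. norm \<bar>indicator {x \<in> \<Omega>. x t i \<le> a} x - f k x\<bar> \<le> 1" for k
          by (intro AE_I2) (auto simp: indicator_def f_def)
        show "(\<lambda>x. \<bar>indicator {x \<in> \<Omega>. x t i \<le> a} x - f k x\<bar>) \<in> borel_measurable P" for k
          using int [OF P H f] by (rule borel_measurable_integrable)
      qed auto
    qed
    have "\<exists>f. lipschitz_test d T f \<and> (\<forall>P\<in>R. (\<integral>x. \<bar>indicator {x \<in> \<Omega>. x t i \<le> a} x - f x\<bar> \<partial>P) < e)"
      if e: "0 < e" for e :: real
    proof -
      have "\<forall>\<^sub>F k in sequentially. \<forall>P\<in>R. (\<integral>x. \<bar>indicator {x \<in> \<Omega>. x t i \<le> a} x - f k x\<bar> \<partial>P) < e"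
        using lim e fin by (intro eventually_ball_finite ballI order_tendstoD(2) [where y = "0 :: real"]) auto
      then obtain k where "\<forall>P\<in>R. (\<integral>x. \<bar>indicator {x \<in> \<Omega>. x t i \<le> a} x - f k x\<bar> \<partial>P) < e"
        unfolding eventually_sequentially by blast
      with f show ?thesis by blast
    qed
    with H show ?thesis by (simp add: CC_def)
  qed
  have sub: "CC \<subseteq> Pow \<Omega>" unfolding CC_def \<Omega>_def using sets.sets_into_space by auto
  have sigma: "sigma_algebra \<Omega> CC"
    unfolding sigma_algebra_iff2 using sub empty compl UN by auto
  define N where "N = sigma \<Omega> CC"
  have N: "sets N = CC" "space N = \<Omega>"
    unfolding N_def by (rule sigma_algebra.sets_measure_of_eq [OF sigma], rule space_measure_of [OF sub])
  have coord: "(\<lambda>x. x t i) \<in> borel_measurable N" if "t \<in> {0..T}" "i < d" for t i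
    unfolding borel_measurable_iff_le N using half [OF that] by simp
  have \<Omega>: "x t \<in> extensional {..<d}" "x \<in> extensional {0..T}" if "x \<in> \<Omega>" "t \<in> {0..T}" for x t
    using that by (auto simp: \<Omega>_def path_space_def state_space_def space_PiM PiE_iff)
  have "(\<lambda>x t. x t) \<in> N \<rightarrow>\<^sub>M path_space d {0..T}"
    unfolding path_space_def
  proof (rule measurable_PiM_single')
    fix t assume t: "t \<in> {0..T}"
    have "(\<lambda>x i. x t i) \<in> N \<rightarrow>\<^sub>M state_space d"
      unfolding state_space_def
      by (rule measurable_PiM_single') (use coord t \<Omega> in \<open>auto simp: N PiE_iff\<close>)
    then show "(\<lambda>x. x t) \<in> N \<rightarrow>\<^sub>M state_space d" by simp
  qed (auto simp: N \<Omega>_def path_space_def space_PiM)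
  then have "(\<lambda>x t. x t) -` E \<inter> space N \<in> sets N" using E by (rule measurable_sets)
  moreover have "(\<lambda>x t. x t) -` E \<inter> space N = E"
    using E sets.sets_into_space by (auto simp: N \<Omega>_def)
  ultimately have "E \<in> CC" by (simp add: N)
  then show ?thesis using \<epsilon> by (rule CC_ex)
qed

section \<open>Two drifts that the observation cannot tell apart\<close>

text \<open>With \<open>r = 1 - \<lambda> / n\<close>, \<open>e = \<delta> / n\<close> and \<open>\<tau> n\<close> observed steps, the cost in \<open>euler_two_point\<close> equals
\<open>\<delta>\<^sup>2 (4 / \<lambda>\<^sup>2 + \<tau> / \<lambda>)\<close> for every mesh, so the inequality passes to the limit. The choice
\<open>h \<ge> 2 / \<lambda>\<close> makes the prehistory long enough for \<open>r\<^sup>h\<^sup>n \<le> 1 / 2\<close>.\<close>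

lemma OU_two_point_test:
  assumes A: "stationary_OU d (ou_drift d lam 0) M\<^sub>A X\<^sub>A Z\<^sub>A"
    and B: "stationary_OU d (ou_drift d lam \<delta>) M\<^sub>B X\<^sub>B Z\<^sub>B"
    and d: "2 \<le> d" and lam: "0 < lam" and T: "T \<le> real \<tau>" and \<tau>: "0 < \<tau>"
    and f: "lipschitz_test d T f" and \<epsilon>: "0 < \<epsilon>"
  shows "(\<integral>x. f x \<partial>distr M\<^sub>B (path_space d {0..T}) (path {0..T} X\<^sub>B))
    \<le> 2 * (\<integral>x. f x \<partial>distr M\<^sub>A (path_space d {0..T}) (path {0..T} X\<^sub>A))
      + exp 1 / 8 + \<delta>\<^sup>2 * (4 / lam\<^sup>2 + real \<tau> / lam) + 3 * \<epsilon>"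
proof -
  define IA where "IA = (\<integral>x. f x \<partial>distr M\<^sub>A (path_space d {0..T}) (path {0..T} X\<^sub>A))"
  define IB where "IB = (\<integral>x. f x \<partial>distr M\<^sub>B (path_space d {0..T}) (path {0..T} X\<^sub>B))"
  define E where "E \<gamma> h n = (\<integral>g. f (euler_path d {0..T} (sample_index h n) (1 - lam / real n) (\<gamma> / real n) g)
        \<partial>PiM ({..<(h + \<tau>) * n} \<times> {..<d}) (\<lambda>_. gauss (1 / real n)))" for \<gamma> h n
  have "\<forall>\<^sub>F h in sequentially. (\<forall>\<^sub>F n in sequentially. \<bar>IA - E 0 h n\<bar> \<le> \<epsilon>) \<and>
      (\<forall>\<^sub>F n in sequentially. \<bar>IB - E \<delta> h n\<bar> \<le> \<epsilon>) \<and> 2 / lam \<le> real h"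
    unfolding IA_def IB_def E_def
    by (intro eventually_conj OU_law_approximation [OF A d lam T \<tau> f \<epsilon>]
        OU_law_approximation [OF B d lam T \<tau> f \<epsilon>])
      (use filterlim_real_sequentially in \<open>simp add: filterlim_at_top\<close>)
  then obtain h where hA: "\<forall>\<^sub>F n in sequentially. \<bar>IA - E 0 h n\<bar> \<le> \<epsilon>"
    and hB: "\<forall>\<^sub>F n in sequentially. \<bar>IB - E \<delta> h n\<bar> \<le> \<epsilon>" and h: "2 / lam \<le> real h"
    unfolding eventually_sequentially by blast
  have "\<forall>\<^sub>F n in sequentially. 2 * lam \<le> real n"
    using filterlim_real_sequentially by (simp add: filterlim_at_top)
  with hA hB have "\<forall>\<^sub>F n in sequentially. \<bar>IA - E 0 h n\<bar> \<le> \<epsilon> \<and> \<bar>IB - E \<delta> h n\<bar> \<le> \<epsilon> \<and> 2 * lam \<le> real n"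
    by (intro eventually_conj)
  then obtain n where nA: "\<bar>IA - E 0 h n\<bar> \<le> \<epsilon>" and nB: "\<bar>IB - E \<delta> h n\<bar> \<le> \<epsilon>" and ln: "2 * lam \<le> real n"
    unfolding eventually_sequentially by blast
  have n: "0 < n" using ln lam by (cases n) auto
  define r where "r = 1 - lam / real n"
  define N where "N = (h + \<tau>) * n"
  define G where "G = PiM ({..<N} \<times> {..<d}) (\<lambda>_. gauss (1 / real n))"
  interpret G: prob_space G
    unfolding G_def by (rule prob_space_PiM) (use n in \<open>simp add: prob_space_gauss\<close>)
  have r: "0 < r" "r < 1" using n lam ln by (auto simp: r_def field_simps)
  have rm: "r ^ (h * n) \<le> 1 / 2"
  proof -
    have "r ^ (h * n) \<le> exp (- (lam * (real (h * n) / real n) / 2))"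
      unfolding r_def by (rule exp_decay_bounds [OF n lam ln])
    also have "\<dots> \<le> exp (- 1)"
      using h n lam by (simp add: field_simps)
    also have "\<dots> \<le> 1 / 2"
      using exp_ge_add_one_self [of 1] by (simp add: exp_minus field_simps)
    finally show ?thesis .
  qed
  have idx: "h * n \<le> sample_index h n t \<and> sample_index h n t \<le> N" if "t \<in> {0..T}" for t
    using sample_index(1,2) [OF n, of t \<tau> h] that T by (auto simp: N_def)
  have fm: "f \<in> borel_measurable (path_space d {0..T})" by (rule lipschitz_testD(1) [OF f])
  have em: "(\<lambda>g. f (euler_path d {0..T} (sample_index h n) r e g)) \<in> borel_measurable G" for e
  proof -
    have "euler_path d {0..T} (sample_index h n) r e \<in> G \<rightarrow>\<^sub>M path_space d {0..T}"
      using measurable_euler_path [of "{0..T}" "sample_index h n" N d r e] idx d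
      unfolding G_def by (simp cong: measurable_cong_sets sets_PiM_cong)
    then show ?thesis by (rule measurable_compose [OF _ fm])
  qed
  have nn: "(\<integral>\<^sup>+g. ennreal (f (euler_path d {0..T} (sample_index h n) r (\<gamma> / real n) g)) \<partial>G) = ennreal (E \<gamma> h n)"
    for \<gamma>
    unfolding E_def r_def [symmetric] N_def [symmetric] G_def [symmetric]
    using lipschitz_testD(2,3) [OF f] em
    by (intro nn_integral_eq_integral G.integrable_const_bound [where B = 1]) (auto intro!: AE_I2)
  have E0: "0 \<le> E \<gamma> h n" for \<gamma>
    unfolding E_def using lipschitz_testD(2) [OF f] by (intro integral_nonneg_AE AE_I2)
  have "ennreal (E \<delta> h n) \<le> 2 * ennreal (E 0 h n) + ennreal (exp 1 / 8)
      + ennreal ((\<delta> / real n)\<^sup>2 * (4 / (1 - r)\<^sup>2 + real (N - h * n) / (1 - r)))"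
    using euler_two_point [of "1 / real n" r "h * n" d "{0..T}" "sample_index h n" N "\<lambda>x. ennreal (f x)" "\<delta> / real n"]
      n r rm d idx fm lipschitz_testD(3) [OF f] nn [of 0] nn [of \<delta>]
    by (simp add: G_def N_def)
  also have "(\<delta> / real n)\<^sup>2 * (4 / (1 - r)\<^sup>2 + real (N - h * n) / (1 - r)) = \<delta>\<^sup>2 * (4 / lam\<^sup>2 + real \<tau> / lam)"
    using n lam by (simp add: r_def N_def field_simps power2_eq_square)
  also have "2 * ennreal (E 0 h n) + ennreal (exp 1 / 8) + ennreal (\<delta>\<^sup>2 * (4 / lam\<^sup>2 + real \<tau> / lam))
      = ennreal (2 * E 0 h n + exp 1 / 8 + \<delta>\<^sup>2 * (4 / lam\<^sup>2 + real \<tau> / lam))"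
    using E0 [of 0] lam by (simp add: ennreal_plus ennreal_mult)
  finally have "E \<delta> h n \<le> 2 * E 0 h n + exp 1 / 8 + \<delta>\<^sup>2 * (4 / lam\<^sup>2 + real \<tau> / lam)"
    using E0 [of 0] lam by (subst (asm) ennreal_le_iff) auto
  with nA nB show ?thesis unfolding IA_def [symmetric] IB_def [symmetric] by linarith
qed

text \<open>The constant is \<open>e / 8 \<le> 3 / 8\<close> plus \<open>1 / 20\<close> plus approximation errors. What counts is that it is
smaller than 1: then \<open>E\<close> cannot have small probability under \<open>P\<close> and at the same time probability close to 1
under \<open>Q\<close>.\<close>

lemma OU_two_point:
  assumes A: "is_OU_law d (ou_drift d lam 0) T P" and B: "is_OU_law d (ou_drift d lam \<delta>) T Q"
    and d: "2 \<le> d" and lam: "0 < lam" and T: "T \<le> real \<tau>" and \<tau>: "0 < \<tau>"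
    and small: "\<delta>\<^sup>2 * (4 / lam\<^sup>2 + real \<tau> / lam) \<le> 1 / 20"
    and E: "E \<in> sets (path_space d {0..T})"
  shows "measure Q E \<le> 2 * measure P E + 1 / 2"
proof -
  obtain M\<^sub>A :: "(real \<Rightarrow> nat \<Rightarrow> real) measure" and X\<^sub>A Z\<^sub>A where A': "stationary_OU d (ou_drift d lam 0) M\<^sub>A X\<^sub>A Z\<^sub>A"
    and P: "P = distr M\<^sub>A (path_space d {0..T}) (path {0..T} X\<^sub>A)"
    using A unfolding is_OU_law_def by blast
  obtain M\<^sub>B :: "(real \<Rightarrow> nat \<Rightarrow> real) measure" and X\<^sub>B Z\<^sub>B where B': "stationary_OU d (ou_drift d lam \<delta>) M\<^sub>B X\<^sub>B Z\<^sub>B"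
    and Q: "Q = distr M\<^sub>B (path_space d {0..T}) (path {0..T} X\<^sub>B)"
    using B unfolding is_OU_law_def by blast
  have law: "prob_space (distr M (path_space d {0..T}) (path {0..T} X))"
    if "stationary_OU d D M X Z" for D and M :: "(real \<Rightarrow> nat \<Rightarrow> real) measure" and X Z
    using that unfolding stationary_OU_def stochastic_process_def
    by (intro prob_space.prob_space_distr measurable_path) auto
  interpret P: prob_space P unfolding P by (rule law [OF A'])
  interpret Q: prob_space Q unfolding Q by (rule law [OF B'])
  have sets: "sets P = sets (path_space d {0..T})" "sets Q = sets (path_space d {0..T})"
    by (simp_all add: P Q)
  obtain f where f: "lipschitz_test d T f"
    and fP: "(\<integral>x. \<bar>indicator E x - f x\<bar> \<partial>P) < 1 / 100" and fQ: "(\<integral>x. \<bar>indicator E x - f x\<bar> \<partial>Q) < 1 / 100"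
    using lipschitz_test_approximation [of "{P, Q}" d T E "1 / 100"] E sets P.prob_space_axioms Q.prob_space_axioms
    by auto
  have close: "\<bar>measure R E - (\<integral>x. f x \<partial>R)\<bar> \<le> (\<integral>x. \<bar>indicator E x - f x\<bar> \<partial>R)"
    if "prob_space R" "sets R = sets (path_space d {0..T})" for R
  proof -
    interpret R: prob_space R by fact
    have [measurable]: "E \<in> sets R" "f \<in> borel_measurable R"
      using that E lipschitz_testD(1) [OF f] measurable_cong_sets by blast+
    have "integrable R f" using lipschitz_testD(2,3) [OF f]
      by (intro R.integrable_const_bound [where B = 1] AE_I2) auto
    then have "measure R E - (\<integral>x. f x \<partial>R) = (\<integral>x. indicator E x - f x \<partial>R)"
      by (subst Bochner_Integration.integral_diff) (auto simp: less_top [symmetric])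
    then show ?thesis using integral_abs_bound [of R "\<lambda>x. indicator E x - f x"] by simp
  qed
  have "(\<integral>x. f x \<partial>Q) \<le> 2 * (\<integral>x. f x \<partial>P) + exp 1 / 8 + \<delta>\<^sup>2 * (4 / lam\<^sup>2 + real \<tau> / lam) + 3 * (1 / 100)"
    unfolding P Q by (rule OU_two_point_test [OF A' B' d lam T \<tau> f]) simp
  moreover have "exp (1 :: real) \<le> 3" by (rule exp_le)
  ultimately show ?thesis
    using close [OF P.prob_space_axioms sets(1)] close [OF Q.prob_space_axioms sets(2)] fP fQ small
    by linarith
qed

lemma ou_drift_in_M_plus:
  assumes "0 < lam"
  shows "ou_drift d lam \<delta> \<in> M_plus d"
proof -
  define A where "A = map_mat complex_of_real (ou_drift d lam \<delta>)"
  have A: "A \<in> carrier_mat d d" by (simp add: A_def ou_drift_def)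
  have "upper_triangular A" by (auto simp: A_def ou_drift_def)
  then have "char_poly A = (\<Prod>a\<leftarrow>diag_mat A. [:- a, 1:])"
    by (rule char_poly_upper_triangular [OF A])
  moreover have "a = complex_of_real lam" if "a \<in> set (diag_mat A)" for a
    using that by (auto simp: A_def ou_drift_def diag_mat_def)
  ultimately have "k = complex_of_real lam" if "eigenvalue A k" for k
    using that by (auto simp: eigenvalue_root_char_poly [OF A] poly_prod_list prod_list_zero_iff)
  then have "\<forall>k. eigenvalue A k \<longrightarrow> 0 < Re k"
    using assms by (metis Re_complex_of_real)
  then show ?thesis
    unfolding M_plus_def A_def by (simp add: ou_drift_def)
qed

lemma ou_drift_in_B_zero:
  assumes "1 \<le> d" "2 * d \<le> s"
  shows "ou_drift d lam \<delta> \<in> B_zero d s"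
proof -
  have "{(i, j). i < d \<and> j < d \<and> ou_drift d lam \<delta> $$ (i, j) \<noteq> 0} \<subseteq> insert (0, 1) ((\<lambda>i. (i, i)) ` {..<d})"
    by (auto simp: ou_drift_def split: if_splits)
  then have "card {(i, j). i < d \<and> j < d \<and> ou_drift d lam \<delta> $$ (i, j) \<noteq> 0}
      \<le> card (insert (0, 1) ((\<lambda>i. (i, i)) ` {..<d}))"
    by (intro card_mono) auto
  also have "\<dots> \<le> Suc (card ((\<lambda>i. (i, i)) ` {..<d}))" by (rule card_insert_le_m1) auto
  also have "\<dots> \<le> Suc d" using card_image_le [of "{..<d}" "\<lambda>i. (i, i)"] by simp
  finally show ?thesis using assms by (simp add: B_zero_def norm0_mat_def ou_drift_def)
qed

lemma entry_le_pnorm_mat: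
  assumes "1 \<le> p" "B \<in> carrier_mat n m" "i < n" "j < m"
  shows "\<bar>B $$ (i, j)\<bar> \<le> pnorm_mat p B"
proof -
  have "\<bar>B $$ (i, j)\<bar> powr p \<le> (\<Sum>j<m. \<bar>B $$ (i, j)\<bar> powr p)"
    by (rule member_le_sum [where f = "\<lambda>j. \<bar>B $$ (i, j)\<bar> powr p"]) (use assms in auto)
  also have "\<dots> \<le> (\<Sum>i<n. \<Sum>j<m. \<bar>B $$ (i, j)\<bar> powr p)"
    by (rule member_le_sum [where f = "\<lambda>i. \<Sum>j<m. \<bar>B $$ (i, j)\<bar> powr p"])
      (use assms in \<open>auto intro: sum_nonneg\<close>)
  finally have "(\<bar>B $$ (i, j)\<bar> powr p) powr (1 / p) \<le> pnorm_mat p B"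
    unfolding pnorm_mat_def using assms by (intro powr_mono2) auto
  then show ?thesis using assms by (simp add: powr_powr)
qed

text \<open>Take \<open>x\<^sub>0\<close> with \<open>l x\<^sub>0 > 0\<close>. Two drifts whose entries \<open>(0, 1)\<close> differ by \<open>\<delta> = 2 x\<^sub>0 \<psi>\<close> force, on an
event \<open>E\<close> under the first or on its complement under the second, a normalized error of at least
\<open>x\<^sub>0\<close>; one of these probabilities is at least \<open>1 / 6\<close>. The error in the \<open>p\<close>-norm is at least the error in
the entry \<open>(0, 1)\<close>.\<close>

theorem theorem2p7:
  fixes l :: "real \<Rightarrow> real"
  assumes "\<And>x. 0 \<le> x \<Longrightarrow> 0 \<le> l x"
    and "mono_on {0..} l"
    and "l 0 = 0"
    and "\<exists>x\<ge>0. l x \<noteq> 0"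
  shows "\<exists>c>0. \<exists>c'>0. \<forall>(d::nat) (s::nat) (p::real) (T::real) P.
    4 \<le> d \<and> 2 * d \<le> s \<and> s \<le> d\<^sup>2 \<and> 1 \<le> p \<and> 0 < T \<and>
    (\<forall>A\<in>M_plus d \<inter> B_zero d s. is_OU_law d A T (P A)) \<longrightarrow>
    ennreal c' \<le>
      (INF Ahat\<in>estimators d T. SUP A\<in>M_plus d \<inter> B_zero d s.
         \<integral>\<^sup>+ x. ennreal (l (c * inverse (psi d s T p) * pnorm_mat p (Ahat x - A))) \<partial>P A)"
proof -
  obtain x0 where x0: "0 \<le> x0" "l x0 \<noteq> 0" using assms(4) by auto
  have l0: "0 < l x0" using assms(1) [OF x0(1)] x0(2) by simp
  have "x0 \<noteq> 0" using x0(2) assms(3) by auto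
  then have x0': "0 < x0" using x0(1) by simp
  have main: "ennreal (l x0 / 6) \<le> (INF Ahat\<in>estimators d T. SUP A\<in>M_plus d \<inter> B_zero d s.
         \<integral>\<^sup>+ x. ennreal (l (1 * inverse (psi d s T p) * pnorm_mat p (Ahat x - A))) \<partial>P A)"
    if d: "4 \<le> d" and s: "2 * d \<le> s" "s \<le> d\<^sup>2" and p: "1 \<le> p" and T: "0 < T"
      and P: "\<forall>A\<in>M_plus d \<inter> B_zero d s. is_OU_law d A T (P A)" for d s :: nat and p T :: real and P
  proof (rule INF_greatest)
    fix Ahat assume Ahat: "Ahat \<in> estimators d T"
    define \<psi> where "\<psi> = psi d s T p"
    have \<psi>: "0 < \<psi>"
    proof -
      have s0: "0 < real s" using d s by simp
      have "real s \<le> real (d\<^sup>2)" using s(2) by (simp only: of_nat_le_iff)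
      then have "1 \<le> (real d)\<^sup>2 / real s" using s0 by simp
      then have "exp 1 * 1 \<le> exp 1 * ((real d)\<^sup>2 / real s)" by (intro mult_left_mono) auto
      then have "ln (exp 1) \<le> ln (exp 1 * (real d)\<^sup>2 / real s)" by (intro ln_mono) auto
      then have "0 < ln (exp 1 * (real d)\<^sup>2 / real s)" by simp
      then show ?thesis unfolding \<psi>_def psi_def using T s0 by (intro mult_pos_pos) auto
    qed
    define \<delta> where "\<delta> = 2 * x0 * \<psi>"
    have \<delta>: "0 < \<delta>" using x0' \<psi> by (simp add: \<delta>_def)
    obtain \<tau> :: nat where \<tau>: "T \<le> real \<tau>" using real_arch_simple by blast
    have \<tau>0: "0 < \<tau>" using T \<tau> by (cases \<tau>) auto
    \<comment> \<open>The damping is chosen last, after the separation \<open>\<delta>\<close> and the horizon \<open>\<tau>\<close>.\<close>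
    define lam where "lam = 1 + 20 * \<delta>\<^sup>2 * (4 + real \<tau>)"
    have lam1: "1 \<le> lam" by (simp add: lam_def)
    have "\<delta>\<^sup>2 * (4 / lam\<^sup>2 + real \<tau> / lam) \<le> \<delta>\<^sup>2 * (4 / lam + real \<tau> / lam)"
      using lam1 by (intro mult_left_mono add_right_mono divide_left_mono) (auto simp: power2_eq_square)
    also have "\<dots> = (lam - 1) / 20 / lam" by (simp add: lam_def add_divide_distrib [symmetric])
    also have "\<dots> \<le> 1 / 20" using lam1 by (simp add: field_simps)
    finally have small: "\<delta>\<^sup>2 * (4 / lam\<^sup>2 + real \<tau> / lam) \<le> 1 / 20" .
    define A B where "A = ou_drift d lam 0" and "B = ou_drift d lam \<delta>"
    have AB: "A \<in> M_plus d \<inter> B_zero d s" "B \<in> M_plus d \<inter> B_zero d s"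
      using lam1 d s by (auto simp: A_def B_def intro!: ou_drift_in_M_plus ou_drift_in_B_zero)
    define risk where "risk D = (\<integral>\<^sup>+ x. ennreal (l (1 * inverse (psi d s T p) * pnorm_mat p (Ahat x - D))) \<partial>P D)" for D
    define E where "E = {x \<in> space (path_space d {0..T}). \<delta> / 2 \<le> \<bar>Ahat x $$ (0, 1)\<bar>}"
    have [measurable]: "(\<lambda>x. Ahat x $$ (0, 1)) \<in> borel_measurable (path_space d {0..T})"
      using Ahat d by (simp add: estimators_def)
    have Em: "E \<in> sets (path_space d {0..T})" unfolding E_def by measurable
    have law: "prob_space (P D) \<and> sets (P D) = sets (path_space d {0..T})" if "D \<in> M_plus d \<inter> B_zero d s" for D
    proof -
      have "is_OU_law d D T (P D)" using P that by blast
      then show ?thesis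
        unfolding is_OU_law_def stationary_OU_def stochastic_process_def
        by (auto intro!: prob_space.prob_space_distr measurable_path)
    qed
    have two: "measure (P B) E \<le> 2 * measure (P A) E + 1 / 2"
      using OU_two_point [of d lam T "P A" \<delta> "P B" \<tau> E] P AB \<tau> \<tau>0 small Em d lam1
      by (auto simp: A_def B_def)
    have risk: "ennreal (l x0 * measure (P D) F) \<le> risk D"
      if D: "D \<in> M_plus d \<inter> B_zero d s" and F: "F \<in> sets (path_space d {0..T})"
        and far: "\<And>x. x \<in> F \<Longrightarrow> \<delta> / 2 \<le> \<bar>(Ahat x - D) $$ (0, 1)\<bar>" for D F
    proof -
      interpret PD: prob_space "P D" using law [OF D] by simp
      have FD: "F \<in> sets (P D)" using law [OF D] F by simp
      have "ennreal (l x0 * measure (P D) F) = (\<integral>\<^sup>+x. ennreal (l x0) * indicator F x \<partial>P D)"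
        using l0 FD by (simp add: nn_integral_cmult_indicator PD.emeasure_eq_measure ennreal_mult)
      also have "\<dots> \<le> risk D"
        unfolding risk_def
      proof (rule nn_integral_mono)
        fix x
        show "ennreal (l x0) * indicator F x \<le> ennreal (l (1 * inverse (psi d s T p) * pnorm_mat p (Ahat x - D)))"
        proof (cases "x \<in> F")
          case True
          have "Ahat x - D \<in> carrier_mat d d" using D by (auto simp: M_plus_def)
          then have "\<delta> / 2 \<le> pnorm_mat p (Ahat x - D)"
            using entry_le_pnorm_mat [OF p, of "Ahat x - D" d d 0 1] far [OF True] d by linarith
          then have "x0 \<le> 1 * inverse \<psi> * pnorm_mat p (Ahat x - D)"
            using \<psi> by (simp add: \<delta>_def field_simps)
          then have "l x0 \<le> l (1 * inverse \<psi> * pnorm_mat p (Ahat x - D))"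
            using x0 by (intro mono_onD [OF assms(2)]) auto
          then show ?thesis using True by (simp add: \<psi>_def ennreal_leI)
        qed simp
      qed
      finally show ?thesis .
    qed
    have car: "A \<in> carrier_mat d d" "B \<in> carrier_mat d d" using AB by (auto simp: M_plus_def)
    have entry: "A $$ (0, 1) = 0" "B $$ (0, 1) = \<delta>" using d by (auto simp: A_def B_def ou_drift_def)
    have diff: "(Ahat x - D) $$ (0, 1) = Ahat x $$ (0, 1) - D $$ (0, 1)" if "D \<in> carrier_mat d d" for x D
      using that d by (intro index_minus_mat(1)) auto
    have rA: "ennreal (l x0 * measure (P A) E) \<le> risk A"
      using AB Em car by (intro risk) (auto simp: E_def diff entry simp del: One_nat_def)
    have rB: "ennreal (l x0 * measure (P B) (space (path_space d {0..T}) - E)) \<le> risk B"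
      using AB Em car \<delta> by (intro risk) (auto simp: E_def diff entry simp del: One_nat_def)
    interpret PB: prob_space "P B" using law [OF AB(2)] by simp
    have "measure (P B) (space (path_space d {0..T}) - E) = 1 - measure (P B) E"
      using PB.prob_compl [of E] law [OF AB(2)] Em by (metis sets_eq_imp_space_eq)
    then have "1 / 6 \<le> measure (P A) E \<or> 1 / 6 \<le> measure (P B) (space (path_space d {0..T}) - E)"
      using two by linarith
    then have "ennreal (l x0 / 6) \<le> risk A \<or> ennreal (l x0 / 6) \<le> risk B"
    proof
      assume "1 / 6 \<le> measure (P A) E"
      then have "l x0 * (1 / 6) \<le> l x0 * measure (P A) E" using l0 by (intro mult_left_mono) auto
      with rA show ?thesis by (metis ennreal_leI order_trans times_divide_eq_right mult.right_neutral)
    next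
      assume "1 / 6 \<le> measure (P B) (space (path_space d {0..T}) - E)"
      then have "l x0 * (1 / 6) \<le> l x0 * measure (P B) (space (path_space d {0..T}) - E)"
        using l0 by (intro mult_left_mono) auto
      with rB show ?thesis by (metis ennreal_leI order_trans times_divide_eq_right mult.right_neutral)
    qed
    then show "ennreal (l x0 / 6) \<le> (SUP A\<in>M_plus d \<inter> B_zero d s.
         \<integral>\<^sup>+ x. ennreal (l (1 * inverse (psi d s T p) * pnorm_mat p (Ahat x - A))) \<partial>P A)"
      unfolding risk_def using AB by (meson SUP_upper order_trans)
  qed
  show ?thesis
    using main l0 by (intro exI [of _ 1] conjI exI [of _ "l x0 / 6"] allI impI) auto
qed

end
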